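(* Let $E$ be an order continuous Banach lattice, let $\varepsilon\ge 0$, and let $T\in B(E)$ be $\varepsilon$-band preserving. Then there exists a band preserving operator $R\in B(E)$ such that $\|R\|\le\|T\|$ and $\|T-R\|\le 4\varepsilon$.
   Context: $B(E)$ denotes the space of bounded linear operators on $E$. A band in a Banach lattice $X$ is an (order) ideal $Y\subset X$ which contains $\bigvee_\alpha y_\alpha$ for every family $(y_\alpha)$ in $Y$ whose supremum exists in $X$. A linear operator $T:X\to X$ is band preserving (BP) if $T(Y)\subset Y$ for every band $Y\subset X$. A linear map $T:X\to X$ is $\varepsilon$-band preserving ($\varepsilon$-BP) if for every $x\in X$, $\sup\{\||Tx|\wedge y\| : y\ge 0,\ y\perp x\}\le\varepsilon\|x\|$. *)

theory Defs
  imports "HOL-Analysis.Analysis" "HOL-Library.Lattice_Algebras" "HOL-Library.Lub_Glb"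
begin

class banach_lattice = banach + ordered_real_vector + lattice_ab_group_add_abs +
  assumes norm_mono_abs: "\<bar>x\<bar> \<le> \<bar>y\<bar> \<Longrightarrow> norm x \<le> norm y"

text \<open>
  A net decreasing to \<open>0\<close> is represented by its range, a downward directed set with infimum \<open>0\<close>;
  as the norm is monotone on the positive cone, the norms tend to \<open>0\<close> along the net
  iff their infimum is \<open>0\<close>.
\<close>

class order_continuous_banach_lattice = banach_lattice +
  assumes order_continuous_norm:
    "D \<noteq> {} \<Longrightarrow> (\<forall>x\<in>D. \<forall>y\<in>D. \<exists>z\<in>D. z \<le> x \<and> z \<le> y)
      \<Longrightarrow> (\<forall>x\<in>D. 0 \<le> x) \<Longrightarrow> (\<forall>b. (\<forall>x\<in>D. b \<le> x) \<longrightarrow> b \<le> 0)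
      \<Longrightarrow> (INF x\<in>D. norm x) = 0"

definition lattice_disjoint :: "'a::lattice_ab_group_add_abs \<Rightarrow> 'a \<Rightarrow> bool"
  where "lattice_disjoint x y \<longleftrightarrow> inf \<bar>x\<bar> \<bar>y\<bar> = 0"

definition order_ideal :: "'a::banach_lattice set \<Rightarrow> bool"
  where "order_ideal Y \<longleftrightarrow> subspace Y \<and> (\<forall>x y. y \<in> Y \<and> \<bar>x\<bar> \<le> \<bar>y\<bar> \<longrightarrow> x \<in> Y)"

definition band :: "'a::banach_lattice set \<Rightarrow> bool"
  where "band Y \<longleftrightarrow> order_ideal Y \<and> (\<forall>A s. A \<subseteq> Y \<and> isLub UNIV A s \<longrightarrow> s \<in> Y)"

definition band_preserving :: "('a::banach_lattice \<Rightarrow> 'a) \<Rightarrow> bool"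
  where "band_preserving T \<longleftrightarrow> linear T \<and> (\<forall>Y. band Y \<longrightarrow> T ` Y \<subseteq> Y)"

text \<open>
  The supremum below is a genuine one: the index set contains \<open>0\<close>, and the norms are
  bounded by \<open>norm (T x)\<close>.
\<close>

definition eps_band_preserving :: "real \<Rightarrow> ('a::banach_lattice \<Rightarrow> 'a) \<Rightarrow> bool"
  where "eps_band_preserving \<epsilon> T \<longleftrightarrow> linear T \<and>
    (\<forall>x. (SUP y\<in>{y. 0 \<le> y \<and> lattice_disjoint y x}. norm (inf \<bar>T x\<bar> y)) \<le> \<epsilon> * norm x)"

end

theory Submission
  imports Defs
begin

text \<open>
  For a band projection \<open>P\<close> let \<open>U = 2P - 1\<close>. Then \<open>T - UTU = 2(PT(1 - P) + (1 - P)TP)\<close> has norm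
  at most \<open>4\<epsilon>\<close>, and averaging such conjugates over finitely many \<open>P\<close> gives operators \<open>S\<close> with
  \<open>\<parallel>S\<parallel> \<le> \<parallel>T\<parallel>\<close> and \<open>\<parallel>T - S\<parallel> \<le> 4\<epsilon>\<close> that commute with any prescribed finite set of band projections.
  By compactness the forms \<open>\<phi>(Su)\<close> accumulate at a bilinear form \<open>B(u, \<phi>)\<close> on \<open>E \<times> E*\<close> with
  \<open>B(Pu, \<phi>) = B(u, \<phi>P)\<close> for all band projections.

  It remains to see that \<open>B\<close> comes from an operator on \<open>E\<close>. A functional that is positive at some
  \<open>x \<ge> 0\<close> is strictly positive on a whole principal band (Zorn's lemma and order continuity).
  Localising to such bands yields first \<open>\<bar>B(u, \<phi>)\<bar> \<le> \<parallel>T\<parallel> \<phi>(u)\<close> for positive \<open>u, \<phi>\<close>, and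
  then that a strict inequality \<open>B(u, \<phi>) > t \<phi>(u)\<close> at one \<open>\<phi>\<close> forces \<open>B \<ge> t\<close> for all
  positive functionals on some band. Hence a maximal positive operator below \<open>B + \<parallel>T\<parallel>\<close>
  represents \<open>B + \<parallel>T\<parallel>\<close>.
\<close>

subsection \<open>Norm and order\<close>

lemma scaleR_sup_distrib:
  fixes a b :: "'a::banach_lattice"
  assumes "0 \<le> c"
  shows "c *\<^sub>R sup a b = sup (c *\<^sub>R a) (c *\<^sub>R b)"
proof (cases "c = 0")
  case False
  with assms have c: "0 < c" by simp
  have "sup a b \<le> inverse c *\<^sub>R sup (c *\<^sub>R a) (c *\<^sub>R b)"
  proof (rule sup_least)
    show "a \<le> inverse c *\<^sub>R sup (c *\<^sub>R a) (c *\<^sub>R b)"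
      using c scaleR_left_mono[of "c *\<^sub>R a" "sup (c *\<^sub>R a) (c *\<^sub>R b)" "inverse c"] by simp
    show "b \<le> inverse c *\<^sub>R sup (c *\<^sub>R a) (c *\<^sub>R b)"
      using c scaleR_left_mono[of "c *\<^sub>R b" "sup (c *\<^sub>R a) (c *\<^sub>R b)" "inverse c"] by simp
  qed
  then have "c *\<^sub>R sup a b \<le> sup (c *\<^sub>R a) (c *\<^sub>R b)"
    using c scaleR_left_mono[of "sup a b" "inverse c *\<^sub>R sup (c *\<^sub>R a) (c *\<^sub>R b)" c] by simp
  moreover have "sup (c *\<^sub>R a) (c *\<^sub>R b) \<le> c *\<^sub>R sup a b"
    using c by (intro sup_least scaleR_left_mono) auto
  ultimately show ?thesis by (rule antisym)
qed simp

lemma scaleR_inf_distrib: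
  fixes a b :: "'a::banach_lattice"
  assumes "0 \<le> c"
  shows "c *\<^sub>R inf a b = inf (c *\<^sub>R a) (c *\<^sub>R b)"
proof -
  have "c *\<^sub>R inf a b = - (c *\<^sub>R sup (- a) (- b))"
    by (subst inf_eq_neg_sup) (rule scaleR_minus_right)
  also have "\<dots> = - sup (- (c *\<^sub>R a)) (- (c *\<^sub>R b))"
    by (subst scaleR_sup_distrib[OF assms]) (simp only: scaleR_minus_right)
  also have "\<dots> = inf (c *\<^sub>R a) (c *\<^sub>R b)"
    by (rule inf_eq_neg_sup[symmetric])
  finally show ?thesis .
qed

lemma pprt_scaleR:
  fixes a :: "'a::banach_lattice"
  shows "0 \<le> c \<Longrightarrow> pprt (c *\<^sub>R a) = c *\<^sub>R pprt a"
  by (simp add: pprt_def scaleR_sup_distrib)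

lemma pprt_add_le:
  fixes a b :: "'a::lattice_ab_group_add"
  shows "pprt (a + b) \<le> pprt a + pprt b"
  unfolding pprt_def by (intro sup_least add_mono add_nonneg_nonneg) auto

lemma norm_abs_lattice [simp]:
  fixes x :: "'a::banach_lattice"
  shows "norm \<bar>x\<bar> = norm x"
  by (intro antisym norm_mono_abs) auto

lemma norm_mono_nonneg:
  fixes x y :: "'a::banach_lattice"
  assumes "0 \<le> x" "x \<le> y"
  shows "norm x \<le> norm y"
  using assms by (intro norm_mono_abs) simp

lemma norm_le_of_abs_le:
  fixes x y :: "'a::banach_lattice"
  assumes "\<bar>x\<bar> \<le> y"
  shows "norm x \<le> norm y"
  using norm_mono_nonneg[OF abs_ge_zero assms] by simp

text \<open>For \<open>a \<in> A\<close> close to \<open>x\<close>, the positive part of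
  \<open>b - x\<close> is dominated by \<open>\<bar>a - x\<bar>\<close>, so its norm is arbitrarily
  small. This is the closedness of the order.\<close>

lemma le_of_closure:
  fixes x b :: "'a::banach_lattice"
  assumes "x \<in> closure A" "\<And>a. a \<in> A \<Longrightarrow> b \<le> a"
  shows "b \<le> x"
proof -
  have small: "norm (pprt (b - x)) < e" if e: "0 < e" for e
  proof -
    obtain a where a: "a \<in> A" "dist a x < e"
      using assms(1) e by (auto simp: closure_approachable)
    have "b - x \<le> \<bar>a - x\<bar>"
      using assms(2)[OF a(1)] by (meson abs_ge_self diff_right_mono order.trans)
    then have "pprt (b - x) \<le> \<bar>a - x\<bar>"
      by (simp add: pprt_def)
    then have "norm (pprt (b - x)) \<le> norm (a - x)"
      using norm_mono_nonneg[OF zero_le_pprt] norm_abs_lattice by metis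
    with a(2) show ?thesis by (simp add: dist_norm)
  qed
  have "pprt (b - x) = 0"
    using small[of "norm (pprt (b - x))"] by fastforce
  then show ?thesis
    by (simp add: le_zero_iff_zero_pprt[symmetric])
qed

lemma closure_le:
  fixes x b :: "'a::banach_lattice"
  assumes "x \<in> closure A" "\<And>a. a \<in> A \<Longrightarrow> a \<le> b"
  shows "x \<le> b"
proof -
  have "- x \<in> closure (uminus ` A)"
    using assms(1) by (simp add: closure_approachable dist_minus)
  then have "- b \<le> - x"
    by (rule le_of_closure) (auto simp: assms(2))
  then show ?thesis by simp
qed

lemma closed_atLeastAtMost_lattice:
  fixes a b :: "'a::banach_lattice"
  shows "closed {a..b}"
proof -
  have "x \<in> {a..b}" if x: "x \<in> closure {a..b}" for x
  proof -
    have "a \<le> x" by (rule le_of_closure[OF x]) simp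
    moreover have "x \<le> b" by (rule closure_le[OF x]) simp
    ultimately show ?thesis by simp
  qed
  then have "closure {a..b} \<subseteq> {a..b}" by blast
  then show ?thesis by (simp only: closure_subset_eq)
qed

section \<open>The Archimedean property and suprema of directed sets\<close>

lemma archimedean_lattice:
  fixes b c :: "'a::banach_lattice"
  assumes "\<And>n::nat. real n *\<^sub>R c \<le> b"
  shows "c \<le> 0"
proof -
  \<comment> \<open>Passing to positive parts makes both sides nonnegative, so that norms can be
    compared.\<close>
  have "real n * norm (pprt c) \<le> norm (pprt b)" for n
  proof -
    have "real n *\<^sub>R pprt c \<le> pprt b"
      using pprt_mono[OF assms[of n]] by (simp add: pprt_scaleR)
    then have "norm (real n *\<^sub>R pprt c) \<le> norm (pprt b)"
      by (intro norm_mono_nonneg) (simp_all add: scaleR_nonneg_nonneg)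
    then show ?thesis by simp
  qed
  then have "norm (pprt c) \<le> 0"
    by (meson ex_less_of_nat_mult not_less)
  then show ?thesis
    by (simp add: le_zero_iff_zero_pprt)
qed

text \<open>Such an \<open>s\<close> is the supremum of \<open>A\<close>, since the order is closed.\<close>

lemma directed_sup_in_closure:
  fixes A :: "'a::order_continuous_banach_lattice set"
  assumes ne: "A \<noteq> {}" and dir: "\<And>x y. x \<in> A \<Longrightarrow> y \<in> A \<Longrightarrow> \<exists>z\<in>A. x \<le> z \<and> y \<le> z"
    and bdd: "\<And>x. x \<in> A \<Longrightarrow> x \<le> u"
  shows "\<exists>s. (\<forall>a\<in>A. a \<le> s) \<and> s \<in> closure A"
proof -
  define Ub where "Ub = {b. \<forall>a\<in>A. a \<le> b}"
  \<comment> \<open>Differences between upper bounds and members of \<open>A\<close>. Once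
    \<open>D\<close> is seen to decrease to 0, order continuity yields upper bounds and members that
    are arbitrarily close in norm.\<close>
  define D where "D = (\<lambda>(b, a). b - a) ` (Ub \<times> A)"
  have uUb: "u \<in> Ub" using bdd by (simp add: Ub_def)
  have "D \<noteq> {}" using ne uUb by (auto simp: D_def)
  moreover have "\<forall>x\<in>D. \<forall>y\<in>D. \<exists>z\<in>D. z \<le> x \<and> z \<le> y"
  proof (intro ballI)
    fix x y assume "x \<in> D" "y \<in> D"
    then obtain b a b' a' where xy: "x = b - a" "y = b' - a'"
      and mem: "b \<in> Ub" "b' \<in> Ub" "a \<in> A" "a' \<in> A"
      by (auto simp: D_def)
    obtain c where c: "c \<in> A" "a \<le> c" "a' \<le> c" using dir mem by blast
    have "inf b b' \<in> Ub" using mem by (simp add: Ub_def)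
    with c have "inf b b' - c \<in> D" by (force simp: D_def)
    moreover have "inf b b' - c \<le> x" "inf b b' - c \<le> y"
      unfolding xy using c by (intro diff_mono; simp)+
    ultimately show "\<exists>z\<in>D. z \<le> x \<and> z \<le> y" by blast
  qed
  moreover have D0: "\<forall>x\<in>D. 0 \<le> x"
    by (auto simp: D_def Ub_def)
  moreover have "\<forall>c. (\<forall>x\<in>D. c \<le> x) \<longrightarrow> c \<le> 0"
  proof (intro allI impI)
    fix c assume c: "\<forall>x\<in>D. c \<le> x"
    \<comment> \<open>A lower bound \<open>c\<close> of \<open>D\<close> may be subtracted from any
      upper bound of \<open>A\<close>. Iterating from \<open>u\<close> puts every multiple of
      \<open>c\<close> below a fixed element, and the Archimedean property applies.\<close>
    have step: "b - c \<in> Ub" if "b \<in> Ub" for b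
    proof -
      have "a \<le> b - c" if "a \<in> A" for a
      proof -
        have "c \<le> b - a" using c that \<open>b \<in> Ub\<close> by (force simp: D_def)
        then show ?thesis by (simp add: le_diff_eq add.commute)
      qed
      then show ?thesis by (simp add: Ub_def)
    qed
    have iter: "u - real n *\<^sub>R c \<in> Ub" for n
    proof (induction n)
      case (Suc n)
      from step[OF Suc] show ?case by (simp add: scaleR_add_left algebra_simps)
    qed (simp add: uUb)
    obtain a where "a \<in> A" using ne by blast
    have "real n *\<^sub>R c \<le> u - a" for n
    proof -
      have "a \<le> u - real n *\<^sub>R c" using iter[of n] \<open>a \<in> A\<close> by (simp add: Ub_def)
      then show ?thesis by (simp add: le_diff_eq add.commute)
    qed
    then show "c \<le> 0" by (rule archimedean_lattice)
  qed
  ultimately have inf0: "(INF x\<in>D. norm x) = 0" by (rule order_continuous_norm)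
  have "\<exists>b\<in>Ub. \<exists>a\<in>A. norm (b - a) < inverse (real (Suc n))" for n
  proof -
    have "Inf (norm ` D) < inverse (real (Suc n))" using inf0 by simp
    from cInf_lessD[OF _ this] \<open>D \<noteq> {}\<close> show ?thesis by (auto simp: D_def)
  qed
  then obtain b a where ab: "\<And>n. b n \<in> Ub" "\<And>n. a n \<in> A"
    "\<And>n. norm (b n - a n) < inverse (real (Suc n))"
    by metis
  \<comment> \<open>Every \<open>a m\<close> lies below every \<open>b n\<close>, which squeezes
    \<open>a m - a n\<close> between \<open>- (b m - a m)\<close> and
    \<open>b n - a n\<close>.\<close>
  have bound: "norm (a m - a n) \<le> norm (b m - a m) + norm (b n - a n)" for m n
  proof -
    have nn: "0 \<le> b k - a k" for k using ab by (simp add: Ub_def)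
    have "a m - a n \<le> b n - a n" using ab by (simp add: Ub_def)
    also have "\<dots> \<le> (b m - a m) + (b n - a n)" using nn[of m] by simp
    finally have 1: "a m - a n \<le> (b m - a m) + (b n - a n)" .
    have "- (a m - a n) \<le> b m - a m" using ab by (simp add: Ub_def)
    also have "\<dots> \<le> (b m - a m) + (b n - a n)" using nn[of n] by simp
    finally have "\<bar>a m - a n\<bar> \<le> (b m - a m) + (b n - a n)"
      using 1 by (intro abs_leI)
    then have "norm (a m - a n) \<le> norm ((b m - a m) + (b n - a n))"
      by (rule norm_le_of_abs_le)
    then show ?thesis using norm_triangle_ineq order.trans by blast
  qed
  have lim0: "(\<lambda>n. norm (b n - a n)) \<longlonglongrightarrow> 0"
    by (rule tendsto_sandwich[OF _ _ tendsto_const LIMSEQ_inverse_real_of_nat])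
       (use less_imp_le[OF ab(3)] in \<open>auto intro!: always_eventually simp del: of_nat_Suc\<close>)
  have "Cauchy a"
  proof (rule metric_CauchyI)
    fix e :: real assume "0 < e"
    then have "\<forall>\<^sub>F n in sequentially. norm (b n - a n) < e / 2"
      using order_tendstoD(2)[OF lim0, of "e / 2"] by simp
    then obtain N where N: "\<And>n. n \<ge> N \<Longrightarrow> norm (b n - a n) < e / 2"
      by (auto simp: eventually_sequentially)
    have "dist (a m) (a n) < e" if "m \<ge> N" "n \<ge> N" for m n
      using bound[of m n] N[OF that(1)] N[OF that(2)] by (simp add: dist_norm)
    then show "\<exists>M. \<forall>m\<ge>M. \<forall>n\<ge>M. dist (a m) (a n) < e" by blast
  qed
  then obtain s where s: "a \<longlonglongrightarrow> s" using Cauchy_convergent_iff convergent_def by blast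
  have "(\<lambda>n. a n + (b n - a n)) \<longlonglongrightarrow> s + 0"
    using tendsto_add[OF s tendsto_norm_zero_cancel[OF lim0]] .
  then have bs: "b \<longlonglongrightarrow> s" by simp
  have "s \<in> closure A" using ab(2) s by (auto simp: closure_sequential)
  \<comment> \<open>The sequence \<open>b\<close> has the same limit, so \<open>s\<close> is also a
    limit of upper bounds and hence an upper bound.\<close>
  moreover have "s \<in> closure Ub" using ab(1) bs by (auto simp: closure_sequential)
  then have "\<forall>a\<in>A. a \<le> s" by (auto intro: le_of_closure simp: Ub_def)
  ultimately show ?thesis by blast
qed

text \<open>Only meaningful for upward directed, order bounded, nonempty sets.\<close>

definition dsup :: "'a::order_continuous_banach_lattice set \<Rightarrow> 'a"
  where "dsup A = (SOME s. (\<forall>a\<in>A. a \<le> s) \<and> s \<in> closure A)"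

lemma
  fixes A :: "'a::order_continuous_banach_lattice set"
  assumes "A \<noteq> {}" "\<And>x y. x \<in> A \<Longrightarrow> y \<in> A \<Longrightarrow> \<exists>z\<in>A. x \<le> z \<and> y \<le> z"
    "\<And>x. x \<in> A \<Longrightarrow> x \<le> u"
  shows dsup_upper: "\<And>a. a \<in> A \<Longrightarrow> a \<le> dsup A"
    and dsup_in_closure: "dsup A \<in> closure A"
  using someI_ex[OF directed_sup_in_closure[OF assms]] unfolding dsup_def by auto

text \<open>Zorn's lemma applies: a nonempty chain is directed, so it has an upper bound in its
  closure, which \<open>Z\<close> contains.\<close>

lemma closed_interval_subset_has_maximal:
  fixes Z :: "'a::order_continuous_banach_lattice set"
  assumes "closed Z" "Z \<noteq> {}" "\<And>z. z \<in> Z \<Longrightarrow> z \<le> u"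
  shows "\<exists>m\<in>Z. \<forall>z\<in>Z. m \<le> z \<longrightarrow> z = m"
proof (rule predicate_Zorn)
  show "partial_order_on Z (relation_of (\<le>) Z)"
    by (auto simp: partial_order_on_def preorder_on_def refl_on_def trans_def antisym_def
        relation_of_def)
next
  fix C assume C: "C \<in> Chains (relation_of (\<le>) Z)"
  then have CZ: "C \<subseteq> Z" and lin: "\<And>x y. x \<in> C \<Longrightarrow> y \<in> C \<Longrightarrow> x \<le> y \<or> y \<le> x"
    by (auto simp: Chains_def relation_of_def)
  show "\<exists>m\<in>Z. \<forall>a\<in>C. a \<le> m"
  proof (cases "C = {}")
    case False
    have "\<exists>s. (\<forall>a\<in>C. a \<le> s) \<and> s \<in> closure C"
      by (rule directed_sup_in_closure[OF False, of u]) (use lin CZ assms(3) in blast)+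
    moreover have "closure C \<subseteq> Z" using CZ assms(1) by (rule closure_minimal)
    ultimately show ?thesis by blast
  qed (use assms(2) in auto)
qed

text \<open>A weak form of the Hahn decomposition. If \<open>m\<close> is maximal in
  \<open>{0..x}\<close> with \<open>\<psi> m \<le> 0\<close>, then \<open>x - m\<close> works: a
  nonzero positive \<open>y \<le> x - m\<close> with \<open>\<psi> y \<le> 0\<close> could be added
  to \<open>m\<close>.\<close>

lemma strictly_positive_piece:
  fixes \<psi> :: "'a::order_continuous_banach_lattice \<Rightarrow> real"
  assumes lin: "bounded_linear \<psi>" and x: "0 \<le> x" "0 < \<psi> x"
  shows "\<exists>w. 0 \<le> w \<and> w \<le> x \<and> w \<noteq> 0 \<and> (\<forall>y. 0 \<le> y \<longrightarrow> y \<le> w \<longrightarrow> y \<noteq> 0 \<longrightarrow> 0 < \<psi> y)"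
proof -
  interpret bounded_linear \<psi> by (rule lin)
  define Z where "Z = {0..x} \<inter> {z. \<psi> z \<le> 0}"
  have "closed {z. \<psi> z \<le> 0}"
    by (intro closed_Collect_le continuous_on continuous_intros)
  then have "closed Z" unfolding Z_def by (intro closed_Int closed_atLeastAtMost_lattice)
  moreover have "0 \<in> Z" using x by (simp add: Z_def zero)
  ultimately obtain m where m: "m \<in> Z" "\<And>z. z \<in> Z \<Longrightarrow> m \<le> z \<Longrightarrow> z = m"
    using closed_interval_subset_has_maximal[of Z x] by (force simp: Z_def)
  show ?thesis
  proof (intro exI[of _ "x - m"] conjI allI impI)
    show "0 \<le> x - m" "x - m \<le> x" using m(1) by (auto simp: Z_def)
    show "x - m \<noteq> 0" using m(1) x by (auto simp: Z_def)
    fix y assume y: "0 \<le> y" "y \<le> x - m" "y \<noteq> 0"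
    show "0 < \<psi> y"
    proof (rule ccontr)
      assume "\<not> 0 < \<psi> y"
      then have "m + y \<in> Z" using m(1) y by (auto simp: Z_def add le_diff_eq add.commute)
      from m(2)[OF this] y show False by simp
    qed
  qed
qed

subsection \<open>Positive functionals\<close>

definition sublinear :: "('a::real_vector \<Rightarrow> real) \<Rightarrow> bool"
  where "sublinear p \<longleftrightarrow> (\<forall>x y. p (x + y) \<le> p x + p y) \<and> (\<forall>c x. 0 < c \<longrightarrow> p (c *\<^sub>R x) \<le> c * p x)"

lemma sublinear_add: "sublinear p \<Longrightarrow> p (x + y) \<le> p x + p y"
  and sublinear_scale_le: "sublinear p \<Longrightarrow> 0 < c \<Longrightarrow> p (c *\<^sub>R x) \<le> c * p x"
  by (simp_all add: sublinear_def)

lemma sublinear_scale: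
  assumes "sublinear p" "0 < c"
  shows "p (c *\<^sub>R x) = c * p x"
proof (rule antisym)
  show "p (c *\<^sub>R x) \<le> c * p x" by (rule sublinear_scale_le[OF assms])
  have "p (inverse c *\<^sub>R (c *\<^sub>R x)) \<le> inverse c * p (c *\<^sub>R x)"
    using assms by (intro sublinear_scale_le) auto
  then show "c * p x \<le> p (c *\<^sub>R x)"
    using assms(2) by (simp add: field_simps)
qed

lemma sublinear_zero:
  assumes "sublinear p"
  shows "p 0 = 0"
  using sublinear_scale[OF assms, of 2 0] by simp

lemma sublinear_neg_le:
  assumes "sublinear p"
  shows "- p (- x) \<le> p x"
  using sublinear_add[OF assms, of x "- x"] sublinear_zero[OF assms] by simp

text \<open>The tool for exploiting minimality: a minimal \<open>p\<close> must equal its shift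
  \<open>q\<close>, and the value of \<open>q\<close> at \<open>- y\<close> then makes
  \<open>p\<close> odd at \<open>y\<close>.\<close>

lemma sublinear_shift:
  fixes p :: "'a::real_vector \<Rightarrow> real" and y :: 'a
  assumes p: "sublinear p"
  defines "q \<equiv> \<lambda>x. INF t\<in>{0..}. p (x + t *\<^sub>R y) - t * p y"
  shows "sublinear q" "\<And>x. q x \<le> p x" "q (- y) \<le> - p y"
proof -
  have bdd: "bdd_below ((\<lambda>t. p (x + t *\<^sub>R y) - t * p y) ` {0..})" for x
  proof (rule bdd_belowI2)
    fix t :: real assume t: "t \<in> {0..}"
    have "p (t *\<^sub>R y) \<le> p (x + t *\<^sub>R y) + p (- x)"
      using sublinear_add[OF p, of "x + t *\<^sub>R y" "- x"] by (simp add: algebra_simps)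
    moreover have "p (t *\<^sub>R y) = t * p y"
      using t sublinear_scale[OF p, of t y] sublinear_zero[OF p] by (cases "t = 0") auto
    ultimately show "- p (- x) \<le> p (x + t *\<^sub>R y) - t * p y" by simp
  qed
  have upper: "q x \<le> p (x + t *\<^sub>R y) - t * p y" if "0 \<le> t" for x t
    unfolding q_def using that by (intro cINF_lower bdd) auto
  have approx: "\<exists>t\<ge>0. p (x + t *\<^sub>R y) - t * p y < q x + e" if "0 < e" for x e
  proof -
    have "Inf ((\<lambda>t. p (x + t *\<^sub>R y) - t * p y) ` {0..}) < q x + e"
      using that by (simp add: q_def)
    from cInf_lessD[OF _ this] show ?thesis by auto
  qed
  show "q x \<le> p x" for x using upper[of 0 x] by simp
  show "q (- y) \<le> - p y" using upper[of 1 "- y"] sublinear_zero[OF p] by simp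
  show "sublinear q"
    unfolding sublinear_def
  proof (intro conjI allI impI)
    fix x x'
    show "q (x + x') \<le> q x + q x'"
    proof (rule field_le_epsilon)
      fix e :: real assume "0 < e"
      then obtain t t' where t: "0 \<le> t" "0 \<le> t'" "p (x + t *\<^sub>R y) - t * p y < q x + e / 2"
        "p (x' + t' *\<^sub>R y) - t' * p y < q x' + e / 2"
        using approx[of "e / 2" x] approx[of "e / 2" x'] by auto
      have "q (x + x') \<le> p (x + x' + (t + t') *\<^sub>R y) - (t + t') * p y"
        using t by (intro upper) simp
      also have "\<dots> \<le> p (x + t *\<^sub>R y) + p (x' + t' *\<^sub>R y) - (t + t') * p y"
        using sublinear_add[OF p, of "x + t *\<^sub>R y" "x' + t' *\<^sub>R y"] by (simp add: algebra_simps)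
      also have "\<dots> \<le> q x + q x' + e"
        using t by (simp add: algebra_simps)
      finally show "q (x + x') \<le> q x + q x' + e" .
    qed
  next
    fix c :: real and x assume c: "0 < c"
    show "q (c *\<^sub>R x) \<le> c * q x"
    proof (rule field_le_epsilon)
      fix e :: real assume "0 < e"
      with c obtain t where t: "0 \<le> t" "p (x + t *\<^sub>R y) - t * p y < q x + e / c"
        using approx[of "e / c" x] by auto
      have "q (c *\<^sub>R x) \<le> p (c *\<^sub>R x + (c * t) *\<^sub>R y) - (c * t) * p y"
        using t c by (intro upper) simp
      also have "\<dots> = c * (p (x + t *\<^sub>R y) - t * p y)"
        using sublinear_scale[OF p c, of "x + t *\<^sub>R y"] by (simp add: algebra_simps)
      also have "\<dots> \<le> c * (q x + e / c)"
        using t c by (intro mult_left_mono) auto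
      also have "\<dots> = c * q x + e" using c by (simp add: field_simps)
      finally show "q (c *\<^sub>R x) \<le> c * q x + e" .
    qed
  qed
qed

text \<open>Zorn's lemma for the reversed pointwise order. The infimum of a chain is finite because
  each member \<open>q\<close> satisfies \<open>- p (- x) \<le> q x\<close>, and it is subadditive
  because of two members that nearly attain it, the smaller one serves both.\<close>

lemma minimal_sublinear_exists:
  fixes p :: "'a::real_vector \<Rightarrow> real"
  assumes p: "sublinear p"
  shows "\<exists>m. (sublinear m \<and> m \<le> p) \<and> (\<forall>q. sublinear q \<longrightarrow> q \<le> m \<longrightarrow> q = m)"
proof -
  define Q where "Q = {q. sublinear q \<and> q \<le> p}"
  have "\<exists>m\<in>Q. \<forall>q\<in>Q. q \<le> m \<longrightarrow> q = m"
  proof (rule predicate_Zorn)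
    show "partial_order_on Q (relation_of (\<lambda>a b. b \<le> a) Q)"
      by (auto simp: partial_order_on_def preorder_on_def refl_on_def trans_def antisym_def
          relation_of_def)
  next
    fix C assume C: "C \<in> Chains (relation_of (\<lambda>a b. b \<le> a) Q)"
    then have CQ: "C \<subseteq> Q" and lin: "\<And>x y. x \<in> C \<Longrightarrow> y \<in> C \<Longrightarrow> x \<le> y \<or> y \<le> x"
      by (auto simp: Chains_def relation_of_def)
    show "\<exists>m\<in>Q. \<forall>a\<in>C. m \<le> a"
    proof (cases "C = {}")
      case True
      then show ?thesis using p by (auto simp: Q_def)
    next
      case False
      define m where "m x = (INF q\<in>C. q x)" for x
      have bdd: "bdd_below ((\<lambda>q. q x) ` C)" for x
      proof (rule bdd_belowI2)
        fix q assume "q \<in> C"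
        then have "sublinear q" "q (- x) \<le> p (- x)" using CQ by (auto simp: Q_def le_fun_def)
        then show "- p (- x) \<le> q x" using sublinear_neg_le[of q x] by simp
      qed
      have lower: "m x \<le> q x" if "q \<in> C" for q x
        unfolding m_def using that by (intro cINF_lower bdd)
      have approx: "\<exists>q\<in>C. q x < m x + e" if "0 < e" for x e
      proof -
        have "Inf ((\<lambda>q. q x) ` C) < m x + e" using that by (simp add: m_def)
        from cInf_lessD[OF _ this] show ?thesis using False by auto
      qed
      have sub: "sublinear q" if "q \<in> C" for q using that CQ by (auto simp: Q_def)
      have "sublinear m"
        unfolding sublinear_def
      proof (intro conjI allI impI)
        fix x y
        show "m (x + y) \<le> m x + m y"
        proof (rule field_le_epsilon)
          fix e :: real assume "0 < e"
          then obtain q r where qr: "q \<in> C" "r \<in> C" "q x < m x + e / 2" "r y < m y + e / 2"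
            using approx[of "e / 2" x] approx[of "e / 2" y] by auto
          obtain s where s: "s \<in> C" "s \<le> q" "s \<le> r" using lin[OF qr(1,2)] qr by auto
          have "m (x + y) \<le> s (x + y)" by (rule lower[OF s(1)])
          also have "\<dots> \<le> s x + s y" by (rule sublinear_add[OF sub[OF s(1)]])
          also have "\<dots> \<le> q x + r y" using s by (intro add_mono) (auto simp: le_fun_def)
          finally show "m (x + y) \<le> m x + m y + e" using qr by simp
        qed
      next
        fix c :: real and x assume c: "0 < c"
        show "m (c *\<^sub>R x) \<le> c * m x"
        proof (rule field_le_epsilon)
          fix e :: real assume "0 < e"
          with c obtain q where q: "q \<in> C" "q x < m x + e / c"
            using approx[of "e / c" x] by auto
          have "m (c *\<^sub>R x) \<le> q (c *\<^sub>R x)" by (rule lower[OF q(1)])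
          also have "\<dots> \<le> c * q x" by (rule sublinear_scale_le[OF sub[OF q(1)] c])
          also have "\<dots> \<le> c * (m x + e / c)" using q c by (intro mult_left_mono) auto
          also have "\<dots> = c * m x + e" using c by (simp add: field_simps)
          finally show "m (c *\<^sub>R x) \<le> c * m x + e" .
        qed
      qed
      moreover have "m \<le> p"
      proof -
        obtain q where "q \<in> C" using False by blast
        then have "m \<le> q" "q \<le> p" using lower CQ by (auto simp: Q_def le_fun_def)
        then show ?thesis by simp
      qed
      ultimately show ?thesis using lower by (auto simp: Q_def le_fun_def intro!: exI[of _ m])
    qed
  qed
  then show ?thesis unfolding Q_def using order.trans by blast
qed

text \<open>A minimal sublinear functional is linear, since no shift can decrease it.\<close>

lemma sublinear_supporting_linear:
  fixes p :: "'a::real_vector \<Rightarrow> real"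
  assumes p: "sublinear p"
  obtains f where "linear f" "\<And>x. f x \<le> p x" "f y = p y"
proof -
  \<comment> \<open>Starting from the shift of \<open>p\<close> at \<open>y\<close> forces every
    linear \<open>f\<close> below it to satisfy \<open>f (- y) \<le> - p y\<close>, hence
    \<open>p y \<le> f y\<close>.\<close>
  define p' where "p' x = (INF t\<in>{0..}. p (x + t *\<^sub>R y) - t * p y)" for x
  have p': "sublinear p'" "\<And>x. p' x \<le> p x" "p' (- y) \<le> - p y"
    unfolding p'_def[abs_def] by (rule sublinear_shift[OF p])+
  obtain f where f: "sublinear f" "f \<le> p'" and min: "\<And>q. sublinear q \<Longrightarrow> q \<le> f \<Longrightarrow> q = f"
    using minimal_sublinear_exists[OF p'(1)] by blast
  have odd: "f (- x) = - f x" for x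
  proof -
    have eq: "(\<lambda>z. INF t\<in>{0..}. f (z + t *\<^sub>R x) - t * f x) = f"
      by (intro min le_funI sublinear_shift[OF f(1)])
    then have "f (- x) \<le> - f x"
      using sublinear_shift(3)[OF f(1), where y = x] fun_cong[OF eq, of "- x"] by linarith
    then show ?thesis using sublinear_neg_le[OF f(1), of x] by simp
  qed
  have "linear f"
  proof (rule linearI)
    show "f (a + b) = f a + f b" for a b
      using sublinear_add[OF f(1), of a b] sublinear_add[OF f(1), of "- a" "- b"]
        odd[of a] odd[of b] odd[of "a + b"] by simp
    show "f (c *\<^sub>R a) = c *\<^sub>R f a" for c a
    proof (cases c "0 :: real" rule: linorder_cases)
      case less
      then show ?thesis using sublinear_scale[OF f(1), of "- c" a] odd[of "c *\<^sub>R a"] by simp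
    qed (use sublinear_zero[OF f(1)] sublinear_scale[OF f(1)] in auto)
  qed
  moreover have "f x \<le> p x" for x using f(2) p'(2)[of x] by (meson le_funD order.trans)
  moreover have "f y = p y"
  proof (rule antisym)
    show "f y \<le> p y" by fact
    have "f (- y) \<le> - p y" using f(2) p'(3) by (meson le_funD order.trans)
    then show "p y \<le> f y" using odd by simp
  qed
  ultimately show ?thesis by (rule that)
qed

section \<open>Positive functionals and the order they determine\<close>

definition positive_functional :: "('a::banach_lattice \<Rightarrow>\<^sub>L real) \<Rightarrow> bool"
  where "positive_functional \<phi> \<longleftrightarrow> (\<forall>u\<ge>0. 0 \<le> blinfun_apply \<phi> u)"

lemma positive_functionalD: "positive_functional \<phi> \<Longrightarrow> 0 \<le> u \<Longrightarrow> 0 \<le> blinfun_apply \<phi> u"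
  by (simp add: positive_functional_def)

lemma positive_functional_mono:
  assumes "positive_functional \<phi>" "u \<le> v"
  shows "blinfun_apply \<phi> u \<le> blinfun_apply \<phi> v"
  using positive_functionalD[OF assms(1), of "v - u"] assms(2) by (simp add: blinfun.diff_right)

lemma positive_functional_add:
  "positive_functional \<phi> \<Longrightarrow> positive_functional \<psi> \<Longrightarrow> positive_functional (\<phi> + \<psi>)"
  by (simp add: positive_functional_def blinfun.add_left)

text \<open>Hahn-Banach for the sublinear functional \<open>norm (pprt x)\<close>. A linear
  functional below it is positive, because \<open>pprt (- u) = 0\<close> for
  \<open>0 \<le> u\<close>, and has norm at most 1, because
  \<open>pprt x \<le> \<bar>x\<bar>\<close>.\<close>

lemma positive_functional_supporting:
  fixes y :: "'a::banach_lattice"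
  obtains \<phi> :: "'a \<Rightarrow>\<^sub>L real"
  where "positive_functional \<phi>" "norm \<phi> \<le> 1" "blinfun_apply \<phi> y = norm (pprt y)"
proof -
  have "sublinear (\<lambda>x::'a. norm (pprt x))"
    unfolding sublinear_def
  proof (intro conjI allI impI)
    fix a b :: 'a
    have "norm (pprt (a + b)) \<le> norm (pprt a + pprt b)"
      by (intro norm_mono_nonneg pprt_add_le zero_le_pprt)
    then show "norm (pprt (a + b)) \<le> norm (pprt a) + norm (pprt b)"
      using norm_triangle_ineq order.trans by blast
  qed (simp add: pprt_scaleR)
  then obtain f where f: "linear f" "\<And>x. f x \<le> norm (pprt x)" "f y = norm (pprt y)"
    using sublinear_supporting_linear[where y = y] by blast
  have le: "f x \<le> norm x" for x
  proof -
    have "pprt x \<le> \<bar>x\<bar>" by (simp add: abs_prts)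
    then have "norm (pprt x) \<le> norm x"
      using norm_mono_nonneg[OF zero_le_pprt] norm_abs_lattice by metis
    then show ?thesis using f(2)[of x] by simp
  qed
  have bd: "\<bar>f x\<bar> \<le> norm x" for x
    using le[of x] le[of "- x"] f(1) by (simp add: linear_neg)
  have bl: "bounded_linear f"
    using f(1) bd by (intro bounded_linear_intro[of f 1]) (auto simp: linear_add linear_scale)
  define \<phi> where "\<phi> = Blinfun f"
  have app: "blinfun_apply \<phi> = f" unfolding \<phi>_def by (rule bounded_linear_Blinfun_apply[OF bl])
  show ?thesis
  proof (rule that[of \<phi>])
    show "positive_functional \<phi>"
      unfolding positive_functional_def app
    proof (intro allI impI)
      fix u :: 'a assume "0 \<le> u"
      then show "0 \<le> f u" using f(2)[of "- u"] f(1) by (simp add: linear_neg pprt_eq_0)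
    qed
    show "norm \<phi> \<le> 1" by (rule norm_blinfun_bound) (simp_all add: app bd)
    show "blinfun_apply \<phi> y = norm (pprt y)" by (simp add: app f(3))
  qed
qed

text \<open>A positive functional whose value at \<open>x - y\<close> is the norm of
  \<open>pprt (x - y)\<close> forces this positive part to vanish.\<close>

lemma le_if_positive_functionals_le:
  fixes x y :: "'a::banach_lattice"
  assumes "\<And>\<phi> :: 'a \<Rightarrow>\<^sub>L real. positive_functional \<phi> \<Longrightarrow> blinfun_apply \<phi> x \<le> blinfun_apply \<phi> y"
  shows "x \<le> y"
proof -
  obtain \<phi> :: "'a \<Rightarrow>\<^sub>L real" where \<phi>: "positive_functional \<phi>" "blinfun_apply \<phi> (x - y) = norm (pprt (x - y))"
    using positive_functional_supporting[of "x - y"] by blast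
  then have "norm (pprt (x - y)) \<le> 0" using assms[OF \<phi>(1)] by (simp only: blinfun.diff_right)
  then have "x - y \<le> 0" by (simp add: le_zero_iff_zero_pprt)
  then show ?thesis by simp
qed

subsection \<open>Band projections\<close>

lemma linear_blinfun_apply: "linear (blinfun_apply f)"
  by (rule bounded_linear.linear[OF blinfun.bounded_linear_right])

lemma eq_on_cone:
  fixes f g :: "'a::banach_lattice \<Rightarrow> 'b::real_vector"
  assumes "linear f" "linear g" "\<And>u. 0 \<le> u \<Longrightarrow> f u = g u"
  shows "f u = g u"
proof -
  have "f u = f (pprt u) - f (- nprt u)"
    using linear_diff[OF assms(1), of "pprt u" "- nprt u"] prts[of u] by simp
  moreover have "g u = g (pprt u) - g (- nprt u)"
    using linear_diff[OF assms(2), of "pprt u" "- nprt u"] prts[of u] by simp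
  ultimately show ?thesis using assms(3)[of "pprt u"] assms(3)[of "- nprt u"] by simp
qed

text \<open>Kantorovich's extension argument: subtract the values at the two parts of
  \<open>u\<close>. Homogeneity is asked for as one inequality, the form that suprema provide; the
  other comes from \<open>inverse c\<close>. The bound by \<open>K\<close> gives continuity.\<close>

lemma cone_map_extends:
  fixes f :: "'a::banach_lattice \<Rightarrow> 'a"
  assumes add: "\<And>u v. 0 \<le> u \<Longrightarrow> 0 \<le> v \<Longrightarrow> f (u + v) = f u + f v"
    and scale_le: "\<And>c u. 0 < c \<Longrightarrow> 0 \<le> u \<Longrightarrow> f u \<le> inverse c *\<^sub>R f (c *\<^sub>R u)"
    and bd: "\<And>u. 0 \<le> u \<Longrightarrow> 0 \<le> f u" "\<And>u. 0 \<le> u \<Longrightarrow> f u \<le> K *\<^sub>R u"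
  obtains R :: "'a \<Rightarrow>\<^sub>L 'a" where "\<And>u. 0 \<le> u \<Longrightarrow> blinfun_apply R u = f u"
proof -
  have f0: "f 0 = 0" using add[of 0 0] by simp
  have scale: "f (c *\<^sub>R u) = c *\<^sub>R f u" if "0 \<le> c" "0 \<le> u" for c u
  proof (cases "c = 0")
    case False
    with that have c: "0 < c" by simp
    have "f (c *\<^sub>R u) \<le> c *\<^sub>R f u"
      using scale_le[of "inverse c" "c *\<^sub>R u"] c that by (simp add: scaleR_nonneg_nonneg)
    moreover have "c *\<^sub>R f u \<le> c *\<^sub>R (inverse c *\<^sub>R f (c *\<^sub>R u))"
      using c that by (intro scaleR_left_mono scale_le) auto
    ultimately show ?thesis using c by (intro antisym) simp_all
  qed (simp add: f0)
  define g where "g u = f (pprt u) - f (- nprt u)" for u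
  have nn: "0 \<le> - nprt u" for u :: 'a by simp
  \<comment> \<open>The value of \<open>g\<close> does not depend on how an element is written as a
    difference of positive ones; linearity follows from this.\<close>
  have diff: "g (a - b) = f a - f b" if ab: "0 \<le> a" "0 \<le> b" for a b
  proof -
    have "pprt (a - b) + b = a + (- nprt (a - b))"
      using prts[of "a - b"] by (simp add: algebra_simps)
    then have "f (pprt (a - b)) + f b = f a + f (- nprt (a - b))"
      using add[OF zero_le_pprt ab(2)] add[OF ab(1) nn] by metis
    then show ?thesis by (simp add: g_def algebra_simps)
  qed
  have dec: "u = pprt u - (- nprt u)" for u :: 'a using prts[of u] by simp
  have "bounded_linear g"
  proof (rule bounded_linear_intro[where K = "\<bar>K\<bar>"])
    fix u v :: 'a
    have eq: "u + v = (pprt u + pprt v) - (- nprt u + - nprt v)"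
      by (subst prts[of u], subst prts[of v]) (simp add: algebra_simps)
    have "g (u + v) = f (pprt u + pprt v) - f (- nprt u + - nprt v)"
      unfolding eq by (intro diff add_nonneg_nonneg nn zero_le_pprt)
    also have "\<dots> = g u + g v"
      using add[OF nn nn, of u v] add[of "pprt u" "pprt v"] by (simp add: g_def)
    finally show "g (u + v) = g u + g v" .
  next
    fix c :: real and u :: 'a
    show "g (c *\<^sub>R u) = c *\<^sub>R g u"
    proof (cases "0 \<le> c")
      case True
      have eq: "c *\<^sub>R u = c *\<^sub>R pprt u - c *\<^sub>R (- nprt u)"
        by (subst dec[of u]) (simp only: scaleR_diff_right)
      have "g (c *\<^sub>R u) = f (c *\<^sub>R pprt u) - f (c *\<^sub>R (- nprt u))"
        unfolding eq using True by (intro diff scaleR_nonneg_nonneg nn zero_le_pprt)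
      then show ?thesis
        using scale[OF True nn] scale[OF True zero_le_pprt] by (simp add: g_def scaleR_diff_right)
    next
      case False
      then have c: "0 \<le> - c" by simp
      have eq: "c *\<^sub>R u = (- c) *\<^sub>R (- nprt u) - (- c) *\<^sub>R pprt u"
        by (subst dec[of u]) (simp add: algebra_simps)
      have "g (c *\<^sub>R u) = f ((- c) *\<^sub>R (- nprt u)) - f ((- c) *\<^sub>R pprt u)"
        unfolding eq using c by (intro diff scaleR_nonneg_nonneg nn zero_le_pprt)
      then show ?thesis
        unfolding scale[OF c nn] scale[OF c zero_le_pprt] by (simp add: g_def algebra_simps)
    qed
  next
    fix u :: 'a
    have b: "0 \<le> f (pprt u)" "0 \<le> f (- nprt u)" "f (pprt u) \<le> K *\<^sub>R pprt u"
      "f (- nprt u) \<le> K *\<^sub>R (- nprt u)"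
      by (intro bd nn zero_le_pprt)+
    have "\<bar>g u\<bar> \<le> \<bar>f (pprt u)\<bar> + \<bar>f (- nprt u)\<bar>"
      unfolding g_def by (rule abs_triangle_ineq4)
    also have "\<dots> = f (pprt u) + f (- nprt u)" using b by simp
    also have "\<dots> \<le> K *\<^sub>R pprt u + K *\<^sub>R (- nprt u)" using b by (intro add_mono)
    also have "\<dots> = K *\<^sub>R \<bar>u\<bar>" by (simp add: abs_prts scaleR_diff_right)
    finally have "norm (g u) \<le> norm (K *\<^sub>R \<bar>u\<bar>)" by (rule norm_le_of_abs_le)
    then show "norm (g u) \<le> norm u * \<bar>K\<bar>" by (simp add: mult.commute)
  qed
  then have app: "blinfun_apply (Blinfun g) = g" by (rule bounded_linear_Blinfun_apply)
  show ?thesis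
    by (intro that[of "Blinfun g"]) (simp add: app g_def f0)
qed

section \<open>Central operators and band projections\<close>

definition central :: "real \<Rightarrow> ('a::banach_lattice \<Rightarrow>\<^sub>L 'a) \<Rightarrow> bool"
  where "central K S \<longleftrightarrow> (\<forall>u\<ge>0. 0 \<le> blinfun_apply S u \<and> blinfun_apply S u \<le> K *\<^sub>R u)"

text \<open>Order projections are described algebraically, as the idempotents between 0 and the
  identity, so that they can be handled without naming the band.\<close>

definition band_projection :: "('a::banach_lattice \<Rightarrow>\<^sub>L 'a) \<Rightarrow> bool"
  where "band_projection P \<longleftrightarrow> central 1 P \<and> P o\<^sub>L P = P"

lemma band_projection_idem: "band_projection P \<Longrightarrow> blinfun_apply P (blinfun_apply P u) = blinfun_apply P u"
  unfolding band_projection_def by (metis blinfun_apply_blinfun_compose)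

lemma central_nonneg: "central K S \<Longrightarrow> 0 \<le> u \<Longrightarrow> 0 \<le> blinfun_apply S u"
  and central_le: "central K S \<Longrightarrow> 0 \<le> u \<Longrightarrow> blinfun_apply S u \<le> K *\<^sub>R u"
  by (simp_all add: central_def)

lemma band_projection_nonneg: "band_projection P \<Longrightarrow> 0 \<le> u \<Longrightarrow> 0 \<le> blinfun_apply P u"
  and band_projection_le: "band_projection P \<Longrightarrow> 0 \<le> u \<Longrightarrow> blinfun_apply P u \<le> u"
  by (simp_all add: band_projection_def central_def)

lemma band_projection_mono:
  assumes "band_projection P" "u \<le> v"
  shows "blinfun_apply P u \<le> blinfun_apply P v" "u - blinfun_apply P u \<le> v - blinfun_apply P v"
  using band_projection_nonneg[OF assms(1), of "v - u"] band_projection_le[OF assms(1), of "v - u"] assms(2)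
  by (simp_all add: blinfun.diff_right algebra_simps)

text \<open>The complement \<open>v - P v\<close> is monotone in \<open>v\<close>, so it vanishes
  below a fixed point \<open>w\<close>.\<close>

lemma band_projection_fixes:
  assumes P: "band_projection P" and "blinfun_apply P w = w" "0 \<le> v" "v \<le> w"
  shows "blinfun_apply P v = v"
  using band_projection_mono(2)[OF P assms(4)] band_projection_le[OF P assms(3)] assms(2) by auto

lemma central_abs_le:
  assumes S: "central K S"
  shows "\<bar>blinfun_apply S u\<bar> \<le> blinfun_apply S \<bar>u\<bar>"
proof (rule abs_leI)
  show "blinfun_apply S u \<le> blinfun_apply S \<bar>u\<bar>"
    using central_nonneg[OF S, of "\<bar>u\<bar> - u"] abs_ge_self[of u] by (simp add: blinfun.diff_right)
  have "0 \<le> \<bar>u\<bar> + u" using add_right_mono[OF abs_ge_minus_self[of u], of u] by simp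
  then show "- blinfun_apply S u \<le> blinfun_apply S \<bar>u\<bar>"
    using central_nonneg[OF S, of "\<bar>u\<bar> + u"] diff_right_mono[of 0 _ "blinfun_apply S u"]
    by (fastforce simp: blinfun.add_right)
qed

lemma central_norm_le:
  assumes S: "central K S" "0 \<le> K"
  shows "norm (blinfun_apply S u) \<le> K * norm u"
proof -
  have "\<bar>blinfun_apply S u\<bar> \<le> K *\<^sub>R \<bar>u\<bar>"
    using central_abs_le[OF S(1)] central_le[OF S(1) abs_ge_zero] order.trans by blast
  from norm_le_of_abs_le[OF this] S(2) show ?thesis by simp
qed

text \<open>Since \<open>S v \<le> K *\<^sub>R v\<close> on the cone, \<open>S\<close> leaves both
  the kernel and the range of \<open>P\<close> invariant; the two halves are
  \<open>P S (u - P u) = 0\<close> and \<open>P S P u = S P u\<close>.\<close>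

lemma central_commutes_band_projection:
  assumes S: "central K S" and P: "band_projection P"
  shows "blinfun_apply S (blinfun_apply P u) = blinfun_apply P (blinfun_apply S u)"
proof (rule eq_on_cone[of "\<lambda>u. blinfun_apply S (blinfun_apply P u)" "\<lambda>u. blinfun_apply P (blinfun_apply S u)"])
  fix u :: 'a assume u: "0 \<le> u"
  have Pu: "0 \<le> blinfun_apply P u" by (rule band_projection_nonneg[OF P u])
  have Qu: "0 \<le> u - blinfun_apply P u" using band_projection_le[OF P u] by simp
  have "blinfun_apply P (blinfun_apply S (u - blinfun_apply P u)) \<le> blinfun_apply P (K *\<^sub>R (u - blinfun_apply P u))"
    by (intro band_projection_mono[OF P] central_le[OF S] Qu)
  also have "\<dots> = 0" by (simp add: blinfun.scaleR_right blinfun.diff_right band_projection_idem[OF P])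
  finally have "blinfun_apply P (blinfun_apply S (u - blinfun_apply P u)) = 0"
    using band_projection_nonneg[OF P central_nonneg[OF S Qu]] by (intro antisym)
  then have 1: "blinfun_apply P (blinfun_apply S u) = blinfun_apply P (blinfun_apply S (blinfun_apply P u))"
    by (simp add: blinfun.diff_right)
  have "blinfun_apply P (K *\<^sub>R blinfun_apply P u) = K *\<^sub>R blinfun_apply P u"
    by (simp add: blinfun.scaleR_right band_projection_idem[OF P])
  then have "blinfun_apply P (blinfun_apply S (blinfun_apply P u)) = blinfun_apply S (blinfun_apply P u)"
    by (rule band_projection_fixes[OF P _ central_nonneg[OF S Pu] central_le[OF S Pu]])
  with 1 show "blinfun_apply S (blinfun_apply P u) = blinfun_apply P (blinfun_apply S u)" by simp
qed (auto intro!: bounded_linear.linear bounded_linear_intros)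

lemma band_projections_commute:
  assumes "band_projection P" "band_projection Q"
  shows "blinfun_apply P (blinfun_apply Q u) = blinfun_apply Q (blinfun_apply P u)"
  using central_commutes_band_projection[of 1 P Q u] assms by (simp add: band_projection_def)

lemma inf_pprt_nprt:
  fixes y :: "'a::lattice_ab_group_add"
  shows "inf (- nprt y) (pprt y) = 0"
proof -
  have "inf (pprt y) (- nprt y) = inf (y + - nprt y) (0 + - nprt y)"
    using prts[of y] by (metis add_0_left diff_add_cancel add_diff_cancel_right' diff_conv_add_uminus)
  also have "\<dots> = inf y 0 + (- nprt y)"
    by (rule add_inf_distrib_right[symmetric])
  also have "\<dots> = 0" by (simp only: nprt_def[symmetric] add.right_inverse)
  finally show ?thesis by (simp only: inf_commute)
qed

section \<open>Projections onto principal bands\<close>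

text \<open>For \<open>0 \<le> u\<close> the projection is the supremum of the truncations
  \<open>inf u (t *\<^sub>R w)\<close> over \<open>0 \<le> t\<close>. The last clause lets an
  inequality between functionals spread from \<open>{0..w}\<close> to the whole band of
  \<open>w\<close>.\<close>

lemma principal_band_projection_exists:
  fixes w :: "'a::order_continuous_banach_lattice"
  assumes w: "0 \<le> w"
  shows "\<exists>P :: 'a \<Rightarrow>\<^sub>L 'a. band_projection P \<and> blinfun_apply P w = w \<and>
    (\<forall>v\<ge>0. inf v w = 0 \<longrightarrow> blinfun_apply P v = 0) \<and>
    (\<forall>\<psi> :: 'a \<Rightarrow> real. bounded_linear \<psi> \<longrightarrow> (\<forall>y. 0 \<le> y \<longrightarrow> y \<le> w \<longrightarrow> 0 \<le> \<psi> y) \<longrightarrow>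
      (\<forall>u\<ge>0. 0 \<le> \<psi> (blinfun_apply P u)))"
proof -
  define A where "A u = (\<lambda>t. inf u (t *\<^sub>R w)) ` {0::real..}" for u
  define f where "f u = dsup (A u)" for u
  have ne: "A u \<noteq> {}" for u by (simp add: A_def)
  have tw: "t *\<^sub>R w \<le> s *\<^sub>R w" if "t \<le> s" for s t
    using that w by (rule scaleR_right_mono)
  have dir: "\<exists>z\<in>A u. x \<le> z \<and> y \<le> z" if "x \<in> A u" "y \<in> A u" for u x y
  proof -
    obtain t s where ts: "0 \<le> t" "0 \<le> s" "x = inf u (t *\<^sub>R w)" "y = inf u (s *\<^sub>R w)"
      using \<open>x \<in> A u\<close> \<open>y \<in> A u\<close> by (auto simp: A_def)
    have "inf u (max t s *\<^sub>R w) \<in> A u" using ts by (auto simp: A_def)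
    moreover have "x \<le> inf u (max t s *\<^sub>R w)" "y \<le> inf u (max t s *\<^sub>R w)"
      unfolding ts by (intro inf_mono order.refl tw; simp)+
    ultimately show ?thesis by blast
  qed
  have bdd: "x \<le> u" if "x \<in> A u" for x u using that by (auto simp: A_def)
  have up: "inf u (t *\<^sub>R w) \<le> f u" if "0 \<le> t" for u t
    unfolding f_def using dsup_upper[OF ne dir bdd, of u u] that by (auto simp: A_def)
  have cl: "f u \<in> closure (A u)" for u
    unfolding f_def using dsup_in_closure[OF ne dir bdd] by blast
  have least: "f u \<le> b" if "\<And>t. 0 \<le> t \<Longrightarrow> inf u (t *\<^sub>R w) \<le> b" for u b
    by (rule closure_le[OF cl]) (use that in \<open>auto simp: A_def\<close>)
  have f_le: "f u \<le> u" for u by (rule least) simp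
  have f_nn: "0 \<le> f u" if "0 \<le> u" for u
    using up[of 0 u] that by (simp add: inf_absorb2)
  have f_add: "f (u + v) = f u + f v" if u: "0 \<le> u" and v: "0 \<le> v" for u v
  proof (rule antisym)
    show "f (u + v) \<le> f u + f v"
    proof (rule least)
      fix t :: real assume t: "0 \<le> t"
      have c: "0 \<le> t *\<^sub>R w" using t w by (rule scaleR_nonneg_nonneg)
      \<comment> \<open>The right-hand side is the sum of the two truncations multiplied out; each
        of its four terms dominates the left-hand side.\<close>
      have "inf (u + v) (t *\<^sub>R w) \<le> inf (inf (u + v) (t *\<^sub>R w + v)) (inf (u + t *\<^sub>R w) (t *\<^sub>R w + t *\<^sub>R w))"
        using u v c by (intro le_infI) (auto intro: le_infI1 le_infI2 simp: add_increasing add_increasing2)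
      also have "\<dots> = inf u (t *\<^sub>R w) + inf v (t *\<^sub>R w)"
        by (simp only: add_inf_distrib_left add_inf_distrib_right)
      also have "\<dots> \<le> f u + f v" using t by (intro add_mono up)
      finally show "inf (u + v) (t *\<^sub>R w) \<le> f u + f v" .
    qed
    \<comment> \<open>Truncations at \<open>t\<close> and \<open>s\<close> add up to at most a
      truncation at \<open>t + s\<close>; the two suprema are then taken one after the
      other.\<close>
    have key: "inf u (t *\<^sub>R w) + inf v (s *\<^sub>R w) \<le> f (u + v)" if "0 \<le> t" "0 \<le> s" for s t
    proof -
      have "inf u (t *\<^sub>R w) + inf v (s *\<^sub>R w) \<le> inf (u + v) ((t + s) *\<^sub>R w)"
        unfolding scaleR_add_left by (intro le_infI add_mono) auto
      also have "\<dots> \<le> f (u + v)" using that by (intro up) simp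
      finally show ?thesis .
    qed
    have "f u \<le> f (u + v) - inf v (s *\<^sub>R w)" if "0 \<le> s" for s
      by (rule least) (use key that in \<open>simp only: le_diff_eq\<close>)
    then have "inf v (s *\<^sub>R w) \<le> f (u + v) - f u" if "0 \<le> s" for s
      using that by (simp only: le_diff_eq add.commute)
    then have "f v \<le> f (u + v) - f u" by (rule least)
    then show "f u + f v \<le> f (u + v)" by (simp add: le_diff_eq add.commute)
  qed
  have f_scale: "f u \<le> inverse c *\<^sub>R f (c *\<^sub>R u)" if c: "0 < c" for c u
  proof (rule least)
    fix t :: real assume t: "0 \<le> t"
    have "c *\<^sub>R inf u (t *\<^sub>R w) = inf (c *\<^sub>R u) ((c * t) *\<^sub>R w)"
      using c by (simp add: scaleR_inf_distrib)
    also have "\<dots> \<le> f (c *\<^sub>R u)" using c t by (intro up) simp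
    finally have "inverse c *\<^sub>R (c *\<^sub>R inf u (t *\<^sub>R w)) \<le> inverse c *\<^sub>R f (c *\<^sub>R u)"
      using c by (intro scaleR_left_mono) auto
    then show "inf u (t *\<^sub>R w) \<le> inverse c *\<^sub>R f (c *\<^sub>R u)" using c by simp
  qed
  obtain P :: "'a \<Rightarrow>\<^sub>L 'a" where P: "\<And>u. 0 \<le> u \<Longrightarrow> blinfun_apply P u = f u"
    by (rule cone_map_extends[of f 1]) (use f_add f_scale f_nn f_le in auto)
  \<comment> \<open>Elements below a multiple of \<open>w\<close> are fixed. So \<open>A u\<close>
    lies in the closed set of fixed points of \<open>P\<close>, and with it
    \<open>f u\<close>.\<close>
  have below: "f v = v" if "v \<le> t *\<^sub>R w" "0 \<le> t" for v t
    using up[of t v] that f_le[of v] by (simp add: inf_absorb1)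
  have idem: "blinfun_apply P (blinfun_apply P u) = blinfun_apply P u" if u: "0 \<le> u" for u
  proof -
    have "closed {v. blinfun_apply P v = v}" by (intro closed_Collect_eq continuous_intros)
    moreover have "A u \<subseteq> {v. blinfun_apply P v = v}"
    proof
      fix v assume "v \<in> A u"
      then obtain t where t: "0 \<le> t" "v = inf u (t *\<^sub>R w)" by (auto simp: A_def)
      then have "0 \<le> v" using u w by (simp add: scaleR_nonneg_nonneg)
      then show "v \<in> {v. blinfun_apply P v = v}" using t below[of v t] by (simp add: P)
    qed
    ultimately have "closure (A u) \<subseteq> {v. blinfun_apply P v = v}" by (intro closure_minimal)
    from subsetD[OF this cl] show ?thesis by (simp add: P[OF u])
  qed
  have "blinfun_apply (P o\<^sub>L P) u = blinfun_apply P u" for u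
    by (rule eq_on_cone[OF linear_blinfun_apply linear_blinfun_apply]) (simp add: idem)
  then have "P o\<^sub>L P = P" by (rule blinfun_eqI)
  then have "band_projection P"
    using P f_nn f_le by (simp add: band_projection_def central_def)
  moreover have "blinfun_apply P w = w" using below[of w 1] w by (simp add: P)
  moreover have "blinfun_apply P v = 0" if v: "0 \<le> v" "inf v w = 0" for v
  proof -
    have "inf v (t *\<^sub>R w) \<le> 0" if t: "0 \<le> t" for t
    proof -
      \<comment> \<open>The factor \<open>t + 1\<close> dominates both coefficients, 1 and
        \<open>t\<close>, and can be taken out of the infimum.\<close>
      have "inf v (t *\<^sub>R w) \<le> inf ((t + 1) *\<^sub>R v) ((t + 1) *\<^sub>R w)"
        using t v tw[of t "t + 1"] scaleR_right_mono[of 1 "t + 1" v] by (intro inf_mono) auto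
      also have "\<dots> = (t + 1) *\<^sub>R inf v w" using t by (subst scaleR_inf_distrib) auto
      finally show ?thesis using v by simp
    qed
    then have "f v \<le> 0" by (rule least)
    then show ?thesis using f_nn[OF v(1)] P[OF v(1)] by simp
  qed
  moreover have "0 \<le> \<psi> (blinfun_apply P u)"
    if \<psi>: "bounded_linear (\<psi> :: 'a \<Rightarrow> real)" "\<And>y. 0 \<le> y \<Longrightarrow> y \<le> w \<Longrightarrow> 0 \<le> \<psi> y" and u: "0 \<le> u" for \<psi> u
  proof -
    interpret bounded_linear \<psi> by (rule \<psi>)
    have "closed {v. 0 \<le> \<psi> v}" by (intro closed_Collect_le continuous_on continuous_intros)
    moreover have "A u \<subseteq> {v. 0 \<le> \<psi> v}"
    proof
      fix v assume "v \<in> A u"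
      then obtain t where t: "0 \<le> t" "v = inf u (t *\<^sub>R w)" by (auto simp: A_def)
      have v: "0 \<le> v" using t u w by (simp add: scaleR_nonneg_nonneg)
      \<comment> \<open>The factor \<open>inverse (t + 1)\<close> moves \<open>v\<close> into
        \<open>{0..w}\<close>, also when \<open>t = 0\<close>.\<close>
      have "0 \<le> \<psi> (inverse (t + 1) *\<^sub>R v)"
      proof (rule \<psi>(2))
        show "0 \<le> inverse (t + 1) *\<^sub>R v" using t v by (intro scaleR_nonneg_nonneg) auto
        have "v \<le> (t + 1) *\<^sub>R w" using t tw[of t "t + 1"] by (auto intro: le_infI2)
        then have "inverse (t + 1) *\<^sub>R v \<le> inverse (t + 1) *\<^sub>R ((t + 1) *\<^sub>R w)"
          using t by (intro scaleR_left_mono) auto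
        then show "inverse (t + 1) *\<^sub>R v \<le> w" using t by simp
      qed
      then show "v \<in> {v. 0 \<le> \<psi> v}" using t(1) by (simp add: scaleR zero_le_mult_iff field_simps)
    qed
    ultimately have "closure (A u) \<subseteq> {v. 0 \<le> \<psi> v}" by (intro closure_minimal)
    from subsetD[OF this cl] show ?thesis by (simp add: P[OF u])
  qed
  ultimately show ?thesis by blast
qed

definition principal_projection :: "'a::order_continuous_banach_lattice \<Rightarrow> 'a \<Rightarrow>\<^sub>L 'a"
  where "principal_projection w = (SOME P. band_projection P \<and> blinfun_apply P w = w \<and>
    (\<forall>v\<ge>0. inf v w = 0 \<longrightarrow> blinfun_apply P v = 0) \<and>
    (\<forall>\<psi> :: 'a \<Rightarrow> real. bounded_linear \<psi> \<longrightarrow> (\<forall>y. 0 \<le> y \<longrightarrow> y \<le> w \<longrightarrow> 0 \<le> \<psi> y) \<longrightarrow>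
      (\<forall>u\<ge>0. 0 \<le> \<psi> (blinfun_apply P u))))"

lemma
  fixes w :: "'a::order_continuous_banach_lattice"
  assumes "0 \<le> w"
  shows band_projection_principal: "band_projection (principal_projection w)"
    and principal_projection_self: "blinfun_apply (principal_projection w) w = w"
    and principal_projection_disjoint: "0 \<le> v \<Longrightarrow> inf v w = 0 \<Longrightarrow> blinfun_apply (principal_projection w) v = 0"
    and functional_nonneg_on_principal: "bounded_linear (\<psi> :: 'a \<Rightarrow> real) \<Longrightarrow>
      (\<And>y. 0 \<le> y \<Longrightarrow> y \<le> w \<Longrightarrow> 0 \<le> \<psi> y) \<Longrightarrow> 0 \<le> u \<Longrightarrow>
      0 \<le> \<psi> (blinfun_apply (principal_projection w) u)"
  using someI_ex[OF principal_band_projection_exists[OF assms], folded principal_projection_def]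
  by blast+

subsection \<open>Local bilinear forms\<close>

text \<open>Modelled on \<open>D u \<phi> = \<phi> (S u)\<close> with \<open>S\<close> commuting
  with all band projections. Weak limits of such operators give forms of this kind that a priori do
  not come from an operator on the space.\<close>

definition local_form :: "('a::order_continuous_banach_lattice \<Rightarrow> ('a \<Rightarrow>\<^sub>L real) \<Rightarrow> real) \<Rightarrow> bool"
  where "local_form D \<longleftrightarrow> (\<forall>\<phi>. bounded_linear (\<lambda>u. D u \<phi>)) \<and> (\<forall>u. linear (D u)) \<and>
    (\<forall>P u \<phi>. band_projection P \<longrightarrow> D (blinfun_apply P u) \<phi> = D u (\<phi> o\<^sub>L P))"

definition dominated_form :: "real \<Rightarrow> ('a::banach_lattice \<Rightarrow> ('a \<Rightarrow>\<^sub>L real) \<Rightarrow> real) \<Rightarrow> bool"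
  where "dominated_form K D \<longleftrightarrow>
    (\<forall>u \<phi>. 0 \<le> u \<longrightarrow> positive_functional \<phi> \<longrightarrow> \<bar>D u \<phi>\<bar> \<le> K * blinfun_apply \<phi> u)"

lemma local_formD:
  assumes "local_form D"
  shows "bounded_linear (\<lambda>u. D u \<phi>)" "linear (D u)"
    "band_projection P \<Longrightarrow> D (blinfun_apply P u) \<phi> = D u (\<phi> o\<^sub>L P)"
  using assms by (auto simp: local_form_def)

lemma dominated_formD:
  "dominated_form K D \<Longrightarrow> 0 \<le> u \<Longrightarrow> positive_functional \<phi> \<Longrightarrow> \<bar>D u \<phi>\<bar> \<le> K * blinfun_apply \<phi> u"
  by (simp add: dominated_form_def)

lemma local_form_linear_combination:
  fixes D D' :: "'a::order_continuous_banach_lattice \<Rightarrow> ('a \<Rightarrow>\<^sub>L real) \<Rightarrow> real"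
  assumes "local_form D" "local_form D'"
  shows "local_form (\<lambda>u \<phi>. a * D u \<phi> + b * D' u \<phi>)"
  unfolding local_form_def
proof (intro conjI allI impI)
  fix \<phi>
  show "bounded_linear (\<lambda>u. a * D u \<phi> + b * D' u \<phi>)"
    by (intro bounded_linear_add bounded_linear_const_mult local_formD assms)
next
  fix u
  show "linear (\<lambda>\<phi>. a * D u \<phi> + b * D' u \<phi>)"
    using local_formD(2)[OF assms(1), of u] local_formD(2)[OF assms(2), of u]
    by (intro linearI) (simp_all add: linear_add linear_scale algebra_simps)
next
  fix P :: "'a \<Rightarrow>\<^sub>L 'a" and u \<phi> assume "band_projection P"
  then show "a * D (blinfun_apply P u) \<phi> + b * D' (blinfun_apply P u) \<phi> =
      a * D u (\<phi> o\<^sub>L P) + b * D' u (\<phi> o\<^sub>L P)"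
    by (simp add: local_formD(3)[OF assms(1)] local_formD(3)[OF assms(2)])
qed

lemma local_form_uminus:
  assumes "local_form D"
  shows "local_form (\<lambda>u \<phi>. - D u \<phi>)"
  using local_form_linear_combination[OF assms assms, of "-1" 0] by simp

lemma local_form_central:
  assumes S: "central K S"
  shows "local_form (\<lambda>u \<phi>. blinfun_apply \<phi> (blinfun_apply S u))"
  unfolding local_form_def
proof (intro conjI allI impI)
  show "bounded_linear (\<lambda>u. blinfun_apply \<phi> (blinfun_apply S u))" for \<phi> :: "'a \<Rightarrow>\<^sub>L real"
    by (intro bounded_linear_intros)
  show "linear (\<lambda>\<phi> :: 'a \<Rightarrow>\<^sub>L real. blinfun_apply \<phi> (blinfun_apply S u))" for u
    by (intro linearI) (simp_all add: blinfun.add_left blinfun.scaleR_left)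
  show "blinfun_apply \<phi> (blinfun_apply S (blinfun_apply P u)) =
      blinfun_apply (\<phi> o\<^sub>L P) (blinfun_apply S u)" if "band_projection P" for P u and \<phi> :: "'a \<Rightarrow>\<^sub>L real"
    by (simp add: central_commutes_band_projection[OF S that])
qed

lemma central_id_blinfun: "central 1 id_blinfun"
  by (simp add: central_def)

lemma local_form_apply: "local_form (\<lambda>u \<phi>. blinfun_apply \<phi> u)"
  using local_form_central[OF central_id_blinfun] by simp

text \<open>
  On a piece where \<open>\<phi>\<close> is nearly proportional to \<open>\<phi>'\<close> (with the optimal constant of
  \<open>\<phi> \<le> c \<phi>'\<close>), a lower bound for \<open>D\<close> at \<open>\<phi>\<close> passes to \<open>\<phi>'\<close>.
  This replaces the Radon-Nikodym theorem.
\<close>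

lemma local_form_lower_bound_transfer:
  fixes D :: "'a::order_continuous_banach_lattice \<Rightarrow> ('a \<Rightarrow>\<^sub>L real) \<Rightarrow> real"
  assumes D: "local_form D" "dominated_form K D" "0 \<le> K"
    and pos: "positive_functional \<phi>" "positive_functional \<phi>'"
    and le: "\<And>u. 0 \<le> u \<Longrightarrow> blinfun_apply \<phi> u \<le> blinfun_apply \<phi>' u"
    and w: "0 \<le> w" "0 < blinfun_apply \<phi> w"
    and low: "\<And>u. 0 \<le> u \<Longrightarrow> u \<le> w \<Longrightarrow> s * blinfun_apply \<phi> u \<le> D u \<phi>"
    and s: "s' < s"
  obtains w' where "0 \<le> w'" "w' \<le> w" "0 < blinfun_apply \<phi>' w'"
    "\<And>u. 0 \<le> u \<Longrightarrow> u \<le> w' \<Longrightarrow> s' * blinfun_apply \<phi>' u \<le> D u \<phi>'"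
proof -
  \<comment> \<open>The constants \<open>c\<close> with \<open>\<phi> \<le> c * \<phi>'\<close> on
    \<open>{0..w}\<close>. The set is closed, bounded below and contains 1, so its infimum is the
    optimal constant.\<close>
  define X where "X = {0..} \<inter> (\<Inter>u\<in>{0..w}. {c. blinfun_apply \<phi> u \<le> c * blinfun_apply \<phi>' u})"
  have "closed X"
    unfolding X_def by (intro closed_Int closed_atLeast closed_INT ballI closed_Collect_le continuous_intros)
  moreover have "1 \<in> X" using le by (auto simp: X_def)
  moreover have bdd: "bdd_below X" by (auto simp: X_def bdd_below_def)
  ultimately have "Inf X \<in> X" by (intro closed_contains_Inf) auto
  define c where "c = Inf X"
  have c0: "0 \<le> c" and c: "\<And>u. 0 \<le> u \<Longrightarrow> u \<le> w \<Longrightarrow> blinfun_apply \<phi> u \<le> c * blinfun_apply \<phi>' u"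
    using \<open>Inf X \<in> X\<close> by (auto simp: X_def c_def)
  have cpos: "0 < c" using c[OF w(1) order.refl] w(2) c0 by (cases "c = 0") auto
  \<comment> \<open>Chosen so that \<open>(K + \<bar>s\<bar>) * \<eta> \<le> s - s'\<close>; the cap
    1/2 keeps \<open>c * (1 - \<eta>)\<close> positive.\<close>
  define \<eta> where "\<eta> = min (1/2) ((s - s') / (K + \<bar>s\<bar> + 1))"
  have \<eta>: "0 < \<eta>" "\<eta> < 1" using s D(3) by (auto simp: \<eta>_def)
  have "(K + \<bar>s\<bar>) * \<eta> \<le> (K + \<bar>s\<bar> + 1) * ((s - s') / (K + \<bar>s\<bar> + 1))"
    using s D(3) \<eta> by (intro mult_mono) (auto simp: \<eta>_def)
  also have "\<dots> = s - s'" using D(3) by simp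
  finally have \<eta>s: "(K + \<bar>s\<bar>) * \<eta> \<le> s - s'" .
  \<comment> \<open>By optimality the smaller constant fails at some \<open>u0\<close>, and a
    strictly positive piece \<open>w'\<close> makes it fail at every nonzero positive element below
    \<open>w'\<close>. There \<open>\<phi>\<close> lies between
    \<open>c * (1 - \<eta>) * \<phi>'\<close> and \<open>c * \<phi>'\<close>.\<close>
  have "c * (1 - \<eta>) < c" using cpos \<eta> by simp
  then have "c * (1 - \<eta>) \<notin> X" using cInf_lower[OF _ bdd] by (force simp: c_def)
  then obtain u0 where u0: "0 \<le> u0" "u0 \<le> w"
    "c * (1 - \<eta>) * blinfun_apply \<phi>' u0 < blinfun_apply \<phi> u0"
    using cpos \<eta> by (auto simp: X_def not_le)
  have "bounded_linear (\<lambda>x. blinfun_apply \<phi> x - c * (1 - \<eta>) * blinfun_apply \<phi>' x)"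
    by (intro bounded_linear_sub bounded_linear_const_mult blinfun.bounded_linear_right)
  from strictly_positive_piece[OF this u0(1)] u0(3)
  obtain w' where w': "0 \<le> w'" "w' \<le> u0" "w' \<noteq> 0"
    and sp: "\<And>y. 0 \<le> y \<Longrightarrow> y \<le> w' \<Longrightarrow> y \<noteq> 0 \<Longrightarrow>
      0 < blinfun_apply \<phi> y - c * (1 - \<eta>) * blinfun_apply \<phi>' y"
    by auto
  define P where "P = principal_projection w'"
  have P: "band_projection P" "blinfun_apply P w' = w'"
    unfolding P_def by (rule band_projection_principal[OF w'(1)] principal_projection_self[OF w'(1)])+
  note Ppos = functional_nonneg_on_principal[OF w'(1), folded P_def]
  \<comment> \<open>The defect is known to be nonnegative on \<open>{0..w}\<close>. Composition with
    \<open>P\<close> makes it a positive functional, to which domination applies; locality removes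
    \<open>P\<close> again below \<open>w'\<close>.\<close>
  define \<kappa> where "\<kappa> = c *\<^sub>R \<phi>' - \<phi>"
  have \<kappa>P: "positive_functional (\<kappa> o\<^sub>L P)"
    unfolding positive_functional_def blinfun_apply_blinfun_compose
  proof (intro allI impI)
    fix u :: 'a assume u: "0 \<le> u"
    show "0 \<le> blinfun_apply \<kappa> (blinfun_apply P u)"
    proof (rule Ppos[OF _ _ u])
      show "bounded_linear (blinfun_apply \<kappa>)" by (rule blinfun.bounded_linear_right)
      fix y assume "0 \<le> y" "y \<le> w'"
      then show "0 \<le> blinfun_apply \<kappa> y"
        using c[of y] w' u0 by (simp add: \<kappa>_def blinfun.diff_left blinfun.scaleR_left)
    qed
  qed
  show ?thesis
  proof (rule that[of w'])
    show "0 \<le> w'" "w' \<le> w" using w' u0 by auto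
    have "0 \<le> c * (1 - \<eta>) * blinfun_apply \<phi>' w'"
      using cpos \<eta> positive_functionalD[OF pos(2) w'(1)] by simp
    then have "0 < blinfun_apply \<phi> w'" using sp[OF w'(1) order.refl w'(3)] by simp
    then show "0 < blinfun_apply \<phi>' w'" using le[OF w'(1)] by simp
    fix u assume u: "0 \<le> u" "u \<le> w'"
    define a where "a = blinfun_apply \<kappa> u"
    have Pu: "blinfun_apply P u = u" by (rule band_projection_fixes[OF P u])
    have a: "a = c * blinfun_apply \<phi>' u - blinfun_apply \<phi> u"
      by (simp add: a_def \<kappa>_def blinfun.diff_left blinfun.scaleR_left)
    have a0: "0 \<le> a" using positive_functionalD[OF \<kappa>P u(1)] by (simp add: a_def Pu)
    have "c * (1 - \<eta>) * blinfun_apply \<phi>' u \<le> blinfun_apply \<phi> u"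
      using sp[OF u] by (cases "u = 0") auto
    then have a1: "a \<le> \<eta> * (c * blinfun_apply \<phi>' u)" by (simp add: a algebra_simps)
    have "D u (\<kappa> o\<^sub>L P) = D u \<kappa>" using local_formD(3)[OF D(1) P(1), of u \<kappa>] by (simp add: Pu)
    moreover have "\<bar>D u (\<kappa> o\<^sub>L P)\<bar> \<le> K * a"
      using dominated_formD[OF D(2) u(1) \<kappa>P] by (simp add: a_def Pu)
    ultimately have "- (K * a) \<le> D u \<kappa>" by simp
    moreover have "D u \<kappa> = c * D u \<phi>' - D u \<phi>"
      using local_formD(2)[OF D(1), of u] by (simp add: \<kappa>_def linear_diff linear_scale)
    \<comment> \<open>Replacing \<open>\<phi>\<close> by \<open>c *\<^sub>R \<phi>'\<close> costs at
      most \<open>K * a\<close>, which is small compared with \<open>c * \<phi>' u\<close>.\<close>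
    ultimately have "D u \<phi> - K * a \<le> c * D u \<phi>'" by simp
    moreover have "s * blinfun_apply \<phi> u \<le> D u \<phi>" using u w' u0 by (intro low) auto
    moreover have "s * blinfun_apply \<phi> u = s * (c * blinfun_apply \<phi>' u) - s * a"
      by (simp add: a algebra_simps)
    moreover have "s * a \<le> \<bar>s\<bar> * a" using a0 by (intro mult_right_mono) auto
    ultimately have "s * (c * blinfun_apply \<phi>' u) - (K + \<bar>s\<bar>) * a \<le> c * D u \<phi>'"
      by (simp add: algebra_simps)
    moreover have "(K + \<bar>s\<bar>) * a \<le> (K + \<bar>s\<bar>) * (\<eta> * (c * blinfun_apply \<phi>' u))"
      using a1 D(3) by (intro mult_left_mono) auto
    moreover have "(K + \<bar>s\<bar>) * \<eta> * (c * blinfun_apply \<phi>' u) \<le> (s - s') * (c * blinfun_apply \<phi>' u)"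
      using \<eta>s cpos positive_functionalD[OF pos(2) u(1)] by (intro mult_right_mono) auto
    ultimately have "c * (s' * blinfun_apply \<phi>' u) \<le> c * D u \<phi>'"
      by (simp add: algebra_simps)
    then show "s' * blinfun_apply \<phi>' u \<le> D u \<phi>'" using cpos by simp
  qed
qed

text \<open>Strict positivity gives a piece \<open>w\<close> on which \<open>D\<close> at
  \<open>\<phi>0\<close> is at least \<open>s * \<phi>0\<close> for some \<open>s > t\<close>. If a
  positive \<open>\<phi>\<close> violated the bound below \<open>w\<close>, both inequalities could
  be transferred to \<open>\<phi>0 + \<phi>\<close> on a common piece, where they contradict each
  other.\<close>

lemma local_form_uniform_lower_bound:
  fixes D :: "'a::order_continuous_banach_lattice \<Rightarrow> ('a \<Rightarrow>\<^sub>L real) \<Rightarrow> real"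
  assumes D: "local_form D" "dominated_form K D" "0 \<le> K"
    and \<phi>0: "positive_functional \<phi>0" and u0: "0 \<le> u0" "t * blinfun_apply \<phi>0 u0 < D u0 \<phi>0"
  shows "\<exists>w. 0 \<le> w \<and> w \<le> u0 \<and> w \<noteq> 0 \<and>
    (\<forall>u \<phi>. 0 \<le> u \<longrightarrow> u \<le> w \<longrightarrow> positive_functional \<phi> \<longrightarrow> t * blinfun_apply \<phi> u \<le> D u \<phi>)"
proof -
  define \<gamma> where "\<gamma> = blinfun_apply \<phi>0 u0"
  \<comment> \<open>A part of the gap small enough that \<open>t < s\<close> and still
    \<open>s * \<gamma> < D u0 \<phi>0\<close>; the denominator contains \<open>\<gamma> + 1\<close>
    since \<open>\<gamma>\<close> may be 0.\<close>
  define s where "s = t + (D u0 \<phi>0 - t * \<gamma>) / (2 * (\<gamma> + 1))"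
  have \<gamma>: "0 \<le> \<gamma>" unfolding \<gamma>_def by (rule positive_functionalD[OF \<phi>0 u0(1)])
  have gap: "0 < D u0 \<phi>0 - t * \<gamma>" using u0 by (simp add: \<gamma>_def)
  have ts: "t < s" using gap \<gamma> by (simp add: s_def)
  have "(D u0 \<phi>0 - t * \<gamma>) * (\<gamma> / (2 * (\<gamma> + 1))) < (D u0 \<phi>0 - t * \<gamma>) * 1"
    using gap \<gamma> by (intro mult_strict_left_mono) (auto simp: field_simps)
  then have "s * \<gamma> < D u0 \<phi>0" by (simp add: s_def algebra_simps)
  then have s0: "0 < D u0 \<phi>0 - s * blinfun_apply \<phi>0 u0" by (simp add: \<gamma>_def)
  have "bounded_linear (\<lambda>u. D u \<phi>0 - s * blinfun_apply \<phi>0 u)"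
    by (intro bounded_linear_sub bounded_linear_const_mult blinfun.bounded_linear_right local_formD(1) D)
  from strictly_positive_piece[OF this u0(1) s0]
  obtain w where w: "0 \<le> w" "w \<le> u0" "w \<noteq> 0"
    and sp: "\<And>y. 0 \<le> y \<Longrightarrow> y \<le> w \<Longrightarrow> y \<noteq> 0 \<Longrightarrow> 0 < D y \<phi>0 - s * blinfun_apply \<phi>0 y"
    by blast
  have dom: "\<bar>D u \<phi>\<bar> \<le> K * blinfun_apply \<phi> u" if "0 \<le> u" "positive_functional \<phi>" for u \<phi>
    using D(2) that by (simp add: dominated_form_def)
  have D': "local_form (\<lambda>u \<phi>. - D u \<phi>)" "dominated_form K (\<lambda>u \<phi>. - D u \<phi>)"
    using D local_form_uminus by (auto simp: dominated_form_def)
  have "t * blinfun_apply \<phi> u \<le> D u \<phi>" if u: "0 \<le> u" "u \<le> w" and \<phi>: "positive_functional \<phi>" for u \<phi>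
  proof (rule ccontr)
    assume "\<not> t * blinfun_apply \<phi> u \<le> D u \<phi>"
    then have neg: "0 < t * blinfun_apply \<phi> u - D u \<phi>" by simp
    have "bounded_linear (\<lambda>u. t * blinfun_apply \<phi> u - D u \<phi>)"
      by (intro bounded_linear_sub bounded_linear_const_mult blinfun.bounded_linear_right local_formD(1) D)
    from strictly_positive_piece[OF this u(1) neg]
    obtain w1 where w1: "0 \<le> w1" "w1 \<le> u" "w1 \<noteq> 0"
      and sp1: "\<And>y. 0 \<le> y \<Longrightarrow> y \<le> w1 \<Longrightarrow> y \<noteq> 0 \<Longrightarrow> 0 < t * blinfun_apply \<phi> y - D y \<phi>"
      by blast
    \<comment> \<open>If \<open>\<phi>\<close> vanished at \<open>w1\<close>, domination would make
      \<open>D w1 \<phi>\<close> vanish too, against the strict inequality. The same argument serves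
      below for \<open>\<phi>0\<close> at \<open>w2\<close>.\<close>
    have "blinfun_apply \<phi> w1 \<noteq> 0"
      using sp1[OF w1(1) order.refl w1(3)] dom[OF w1(1) \<phi>] by auto
    then have \<phi>w1: "0 < blinfun_apply \<phi> w1" using positive_functionalD[OF \<phi> w1(1)] by simp
    define m where "m = (s + t) / 2"
    have m: "t < m" "m < s" using ts by (auto simp: m_def)
    define \<phi>1 where "\<phi>1 = \<phi>0 + \<phi>"
    have \<phi>1: "positive_functional \<phi>1" unfolding \<phi>1_def by (intro positive_functional_add \<phi> \<phi>0)
    have le1: "blinfun_apply \<phi> y \<le> blinfun_apply \<phi>1 y" "blinfun_apply \<phi>0 y \<le> blinfun_apply \<phi>1 y"
      if "0 \<le> y" for y
      using positive_functionalD[OF \<phi> that] positive_functionalD[OF \<phi>0 that]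
      by (auto simp: \<phi>1_def blinfun.add_left)
    have low1: "- t * blinfun_apply \<phi> y \<le> - D y \<phi>" if "0 \<le> y" "y \<le> w1" for y
    proof (cases "y = 0")
      case True
      then show ?thesis using dom[OF _ \<phi>, of 0] by simp
    qed (use sp1[OF that] in simp)
    \<comment> \<open>The upper bound \<open>t\<close> for \<open>D\<close> is transferred as a
      lower bound for \<open>- D\<close>, losing no more than the way to the midpoint
      \<open>m\<close>.\<close>
    have mt: "- m < - t" using m by simp
    obtain w2 where w2: "0 \<le> w2" "w2 \<le> w1" "0 < blinfun_apply \<phi>1 w2"
      and up: "\<And>y. 0 \<le> y \<Longrightarrow> y \<le> w2 \<Longrightarrow> - m * blinfun_apply \<phi>1 y \<le> - D y \<phi>1"
      by (rule local_form_lower_bound_transfer[OF D' D(3) \<phi> \<phi>1 le1(1) w1(1) \<phi>w1 low1 mt]) auto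
    have w2w: "w2 \<le> w" using w2 w1 u by auto
    have "w2 \<noteq> 0" using w2(3) by auto
    then have "blinfun_apply \<phi>0 w2 \<noteq> 0"
      using sp[OF w2(1) w2w] dom[OF w2(1) \<phi>0] by auto
    then have \<phi>w2: "0 < blinfun_apply \<phi>0 w2" using positive_functionalD[OF \<phi>0 w2(1)] by simp
    have low2: "s * blinfun_apply \<phi>0 y \<le> D y \<phi>0" if "0 \<le> y" "y \<le> w2" for y
    proof (cases "y = 0")
      case True
      then show ?thesis using dom[OF _ \<phi>0, of 0] by simp
    qed (use sp[of y] that order.trans[OF that(2) w2w] in auto)
    \<comment> \<open>The lower bound \<open>s\<close> is relaxed halfway towards \<open>m\<close>,
      so it still exceeds the upper bound \<open>m\<close> already valid below
      \<open>w2\<close>.\<close>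
    have m': "(m + s) / 2 < s" using m by simp
    obtain w3 where w3: "0 \<le> w3" "w3 \<le> w2" "0 < blinfun_apply \<phi>1 w3"
      and lo: "\<And>y. 0 \<le> y \<Longrightarrow> y \<le> w3 \<Longrightarrow> (m + s) / 2 * blinfun_apply \<phi>1 y \<le> D y \<phi>1"
      by (rule local_form_lower_bound_transfer[OF D \<phi>0 \<phi>1 le1(2) w2(1) \<phi>w2 low2 m']) auto
    have "(m + s) / 2 * blinfun_apply \<phi>1 w3 \<le> m * blinfun_apply \<phi>1 w3"
      using lo[OF w3(1) order.refl] up[OF w3(1,2)] by simp
    then have "(m + s) / 2 \<le> m" using w3(3) by (rule mult_right_le_imp_le)
    then show False using m by simp
  qed
  then show ?thesis using w by blast
qed

text \<open>Otherwise \<open>B\<close> exceeds \<open>C' * \<phi>0\<close> on a piece, for some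
  \<open>C' > C\<close>. Restricting \<open>\<phi>0\<close> to the band of this piece gives
  \<open>\<phi>\<close> with \<open>C' * \<phi> \<le> B\<close>, so the norm bound yields
  \<open>norm \<phi> \<le> C / C' * norm \<phi>\<close>. Hence \<open>\<phi> = 0\<close>, which the
  strict inequality excludes.\<close>

lemma local_form_le_norm_bound:
  fixes B :: "'a::order_continuous_banach_lattice \<Rightarrow> ('a \<Rightarrow>\<^sub>L real) \<Rightarrow> real"
  assumes B: "local_form B" and bd: "\<And>u \<phi>. B u \<phi> \<le> C * norm u * norm \<phi>" and C: "0 \<le> C"
    and u0: "0 \<le> u0" and \<phi>0: "positive_functional \<phi>0"
  shows "B u0 \<phi>0 \<le> C * blinfun_apply \<phi>0 u0"
proof (rule ccontr)
  assume "\<not> ?thesis"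
  then have lt: "C * blinfun_apply \<phi>0 u0 < B u0 \<phi>0" by simp
  define \<gamma> where "\<gamma> = blinfun_apply \<phi>0 u0"
  define C' where "C' = C + (B u0 \<phi>0 - C * \<gamma>) / (2 * (\<gamma> + 1))"
  have \<gamma>: "0 \<le> \<gamma>" unfolding \<gamma>_def by (rule positive_functionalD[OF \<phi>0 u0])
  have gap: "0 < B u0 \<phi>0 - C * \<gamma>" using lt by (simp add: \<gamma>_def)
  have CC': "C < C'" using gap \<gamma> by (simp add: C'_def)
  have "(B u0 \<phi>0 - C * \<gamma>) * (\<gamma> / (2 * (\<gamma> + 1))) < (B u0 \<phi>0 - C * \<gamma>) * 1"
    using gap \<gamma> by (intro mult_strict_left_mono) (auto simp: field_simps)
  then have "C' * \<gamma> < B u0 \<phi>0" by (simp add: C'_def algebra_simps)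
  then have s0: "0 < B u0 \<phi>0 - C' * blinfun_apply \<phi>0 u0" by (simp add: \<gamma>_def)
  have bl: "bounded_linear (\<lambda>u. B u \<phi>0 - C' * blinfun_apply \<phi>0 u)"
    by (intro bounded_linear_sub bounded_linear_const_mult blinfun.bounded_linear_right local_formD(1) B)
  from strictly_positive_piece[OF this u0 s0]
  obtain w where w: "0 \<le> w" "w \<noteq> 0"
    and sp: "\<And>y. 0 \<le> y \<Longrightarrow> y \<le> w \<Longrightarrow> y \<noteq> 0 \<Longrightarrow> 0 < B y \<phi>0 - C' * blinfun_apply \<phi>0 y"
    by blast
  define P where "P = principal_projection w"
  have P: "band_projection P" "blinfun_apply P w = w"
    unfolding P_def by (rule band_projection_principal[OF w(1)] principal_projection_self[OF w(1)])+
  note Ppos = functional_nonneg_on_principal[OF w(1), folded P_def]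
  define \<phi> where "\<phi> = \<phi>0 o\<^sub>L P"
  have nn: "0 \<le> B y \<phi>0 - C' * blinfun_apply \<phi>0 y" if "0 \<le> y" "y \<le> w" for y
  proof (cases "y = 0")
    case True
    then show ?thesis using linear_0[OF bounded_linear.linear[OF bl]] by simp
  qed (use sp[OF that] in simp)
  have pos: "positive_functional \<phi>"
    unfolding positive_functional_def \<phi>_def
    by (auto intro: positive_functionalD[OF \<phi>0] band_projection_nonneg[OF P(1)])
  have est: "C' * blinfun_apply \<phi> y \<le> C * norm \<phi> * norm y" if "0 \<le> y" for y
  proof -
    have "C' * blinfun_apply \<phi> y \<le> B (blinfun_apply P y) \<phi>0"
      using Ppos[OF bl nn that] by (simp add: \<phi>_def)
    also have "\<dots> = B y \<phi>" unfolding \<phi>_def by (rule local_formD(3)[OF B P(1)])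
    also have "\<dots> \<le> C * norm \<phi> * norm y" using bd[of y \<phi>] by (simp add: mult_ac)
    finally show ?thesis .
  qed
  have "norm \<phi> \<le> C / C' * norm \<phi>"
  proof (rule norm_blinfun_bound)
    show "0 \<le> C / C' * norm \<phi>" using C CC' by simp
    fix y
    have "\<bar>blinfun_apply \<phi> y\<bar> \<le> blinfun_apply \<phi> \<bar>y\<bar>"
      using positive_functional_mono[OF pos, of y "\<bar>y\<bar>"] positive_functional_mono[OF pos, of "- y" "\<bar>y\<bar>"]
        abs_ge_self[of y] abs_ge_minus_self[of y]
      by (simp add: blinfun.minus_right)
    also have "\<dots> \<le> C / C' * norm \<phi> * norm y"
      using est[of "\<bar>y\<bar>"] C CC' by (simp add: field_simps)
    finally show "norm (blinfun_apply \<phi> y) \<le> C / C' * norm \<phi> * norm y" by simp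
  qed
  then have "(C' - C) * norm \<phi> \<le> 0" using C CC' by (simp add: field_simps)
  then have "\<phi> = 0" using CC' by (simp add: mult_le_0_iff)
  then have "B w \<phi> = 0" "blinfun_apply \<phi> w = 0" using linear_0[OF local_formD(2)[OF B]] by auto
  then have "B w \<phi>0 - C' * blinfun_apply \<phi>0 w = 0"
    using local_formD(3)[OF B P(1), of w \<phi>0] by (simp add: \<phi>_def P(2))
  then show False using sp[OF w(1) order.refl w(2)] by simp
qed

text \<open>
  The operator is a maximal element of the set of positive operators below the form;
  a gap could be filled by a multiple of a principal band projection.
\<close>

lemma local_form_represented:
  fixes D :: "'a::order_continuous_banach_lattice \<Rightarrow> ('a \<Rightarrow>\<^sub>L real) \<Rightarrow> real"
  assumes D: "local_form D" "dominated_form K D" "0 \<le> K"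
    and D0: "\<And>u \<phi>. 0 \<le> u \<Longrightarrow> positive_functional \<phi> \<Longrightarrow> 0 \<le> D u \<phi>"
  shows "\<exists>S. central K S \<and> (\<forall>u \<phi>. positive_functional \<phi> \<longrightarrow> blinfun_apply \<phi> (blinfun_apply S u) = D u \<phi>)"
proof -
  define \<S> where "\<S> = {S :: 'a \<Rightarrow>\<^sub>L 'a. \<forall>u\<ge>0. 0 \<le> blinfun_apply S u \<and>
    (\<forall>\<phi>. positive_functional \<phi> \<longrightarrow> blinfun_apply \<phi> (blinfun_apply S u) \<le> D u \<phi>)}"
  define L where "L S S' \<longleftrightarrow> (\<forall>u\<ge>0. blinfun_apply S u \<le> blinfun_apply S' u)" for S S' :: "'a \<Rightarrow>\<^sub>L 'a"
  have dom: "D u \<phi> \<le> K * blinfun_apply \<phi> u" if "0 \<le> u" "positive_functional \<phi>" for u \<phi>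
    using D(2) that unfolding dominated_form_def by (meson abs_le_D1)
  have central: "central K S" if "S \<in> \<S>" for S
    unfolding central_def
  proof (intro allI impI conjI)
    fix u :: 'a assume u: "0 \<le> u"
    show "0 \<le> blinfun_apply S u" using that u by (simp add: \<S>_def)
    show "blinfun_apply S u \<le> K *\<^sub>R u"
    proof (rule le_if_positive_functionals_le)
      fix \<phi> :: "'a \<Rightarrow>\<^sub>L real" assume \<phi>: "positive_functional \<phi>"
      have "blinfun_apply \<phi> (blinfun_apply S u) \<le> D u \<phi>" using that u \<phi> by (simp add: \<S>_def)
      also have "\<dots> \<le> K * blinfun_apply \<phi> u" by (rule dom[OF u \<phi>])
      finally show "blinfun_apply \<phi> (blinfun_apply S u) \<le> blinfun_apply \<phi> (K *\<^sub>R u)"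
        by (simp add: blinfun.scaleR_right)
    qed
  qed
  have "\<exists>M\<in>\<S>. \<forall>S\<in>\<S>. L M S \<longrightarrow> S = M"
  proof (rule predicate_Zorn)
    have "S = S'" if "L S S'" "L S' S" for S S'
    proof (rule blinfun_eqI)
      show "blinfun_apply S u = blinfun_apply S' u" for u
        by (rule eq_on_cone[OF linear_blinfun_apply linear_blinfun_apply])
           (use that in \<open>auto simp: L_def intro: antisym\<close>)
    qed
    moreover have "L S S" for S by (simp add: L_def)
    moreover have "L S S''" if "L S S'" "L S' S''" for S S' S''
      using that unfolding L_def by (meson order.trans)
    ultimately show "partial_order_on \<S> (relation_of L \<S>)"
      unfolding partial_order_on_def preorder_on_def refl_on_def trans_def antisym_def relation_of_def
      by blast
  next
    fix C assume C: "C \<in> Chains (relation_of L \<S>)"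
    then have CS: "C \<subseteq> \<S>" and lin: "\<And>S S'. S \<in> C \<Longrightarrow> S' \<in> C \<Longrightarrow> L S S' \<or> L S' S"
      by (auto simp: Chains_def relation_of_def)
    show "\<exists>M\<in>\<S>. \<forall>S\<in>C. L S M"
    proof (cases "C = {}")
      case True
      moreover have "0 \<in> \<S>" using D0 by (simp add: \<S>_def)
      ultimately show ?thesis by auto
    next
      case False
      define A where "A u = (\<lambda>S. blinfun_apply S u) ` C" for u
      define f where "f u = dsup (A u)" for u
      have ne: "A u \<noteq> {}" for u using False by (simp add: A_def)
      have dir: "\<exists>z\<in>A u. x \<le> z \<and> y \<le> z" if "0 \<le> u" "x \<in> A u" "y \<in> A u" for u x y
        using that lin unfolding A_def L_def by blast
      have bdd: "x \<le> K *\<^sub>R u" if "0 \<le> u" "x \<in> A u" for u x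
        using that CS central central_le by (fastforce simp: A_def)
      have up: "blinfun_apply S u \<le> f u" if "0 \<le> u" "S \<in> C" for u S
        unfolding f_def using dsup_upper[OF ne dir bdd, of u u] that by (auto simp: A_def)
      have cl: "f u \<in> closure (A u)" if "0 \<le> u" for u
        unfolding f_def using dsup_in_closure[OF ne dir bdd] that by blast
      have least: "f u \<le> b" if "0 \<le> u" "\<And>S. S \<in> C \<Longrightarrow> blinfun_apply S u \<le> b" for u b
        by (rule closure_le[OF cl[OF that(1)]]) (use that in \<open>auto simp: A_def\<close>)
      have f_le: "f u \<le> K *\<^sub>R u" if "0 \<le> u" for u
        by (rule closure_le[OF cl[OF that] bdd[OF that]])
      have f_nn: "0 \<le> f u" if u: "0 \<le> u" for u
      proof -
        obtain S where "S \<in> C" using False by blast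
        then have "0 \<le> blinfun_apply S u" using CS u by (auto simp: \<S>_def)
        also have "\<dots> \<le> f u" by (rule up[OF u \<open>S \<in> C\<close>])
        finally show ?thesis .
      qed
      have f_add: "f (u + v) = f u + f v" if u: "0 \<le> u" and v: "0 \<le> v" for u v
      proof (rule antisym)
        have uv: "0 \<le> u + v" using u v by simp
        show "f (u + v) \<le> f u + f v"
          by (rule least[OF uv]) (auto simp: blinfun.add_right intro: add_mono up u v)
        \<comment> \<open>Comparability in the chain supplies one operator above both
          \<open>S\<close> and \<open>S'\<close>.\<close>
        have key: "blinfun_apply S u + blinfun_apply S' v \<le> f (u + v)" if SS': "S \<in> C" "S' \<in> C" for S S'
        proof -
          obtain M where M: "M \<in> C" "L S M" "L S' M"
            using lin[OF SS'] SS' by (auto simp: L_def)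
          then have "blinfun_apply S u + blinfun_apply S' v \<le> blinfun_apply M u + blinfun_apply M v"
            using u v by (intro add_mono) (auto simp: L_def)
          also have "\<dots> \<le> f (u + v)" using up[OF uv M(1)] by (simp add: blinfun.add_right)
          finally show ?thesis .
        qed
        have "f u \<le> f (u + v) - blinfun_apply S' v" if "S' \<in> C" for S'
          by (rule least[OF u]) (use key that in \<open>simp add: le_diff_eq\<close>)
        then have "f v \<le> f (u + v) - f u"
          by (intro least[OF v]) (simp add: le_diff_eq add.commute)
        then show "f u + f v \<le> f (u + v)" by (simp add: le_diff_eq add.commute)
      qed
      have f_scale: "f u \<le> inverse c *\<^sub>R f (c *\<^sub>R u)" if c: "0 < c" and u: "0 \<le> u" for c u
      proof (rule least[OF u])
        fix S assume "S \<in> C"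
        moreover have "0 \<le> c *\<^sub>R u" using c u by (intro scaleR_nonneg_nonneg) auto
        ultimately have "inverse c *\<^sub>R blinfun_apply S (c *\<^sub>R u) \<le> inverse c *\<^sub>R f (c *\<^sub>R u)"
          using c by (intro scaleR_left_mono up) auto
        then show "blinfun_apply S u \<le> inverse c *\<^sub>R f (c *\<^sub>R u)"
          using c by (simp add: blinfun.scaleR_right)
      qed
      obtain M :: "'a \<Rightarrow>\<^sub>L 'a" where M: "\<And>u. 0 \<le> u \<Longrightarrow> blinfun_apply M u = f u"
        by (rule cone_map_extends[of f K]) (use f_add f_scale f_nn f_le in auto)
      have "blinfun_apply \<phi> (f u) \<le> D u \<phi>" if u: "0 \<le> u" and \<phi>: "positive_functional \<phi>" for u \<phi>
      proof -
        have "closed {v. blinfun_apply \<phi> v \<le> D u \<phi>}" by (intro closed_Collect_le continuous_intros)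
        moreover have "A u \<subseteq> {v. blinfun_apply \<phi> v \<le> D u \<phi>}"
          using CS u \<phi> by (auto simp: A_def \<S>_def)
        ultimately show ?thesis using cl[OF u] closure_minimal by blast
      qed
      then have "M \<in> \<S>" using M f_nn by (simp add: \<S>_def)
      moreover have "\<forall>S\<in>C. L S M" using M up by (simp add: L_def)
      ultimately show ?thesis by blast
    qed
  qed
  then obtain S where S: "S \<in> \<S>" and max: "\<And>S'. S' \<in> \<S> \<Longrightarrow> L S S' \<Longrightarrow> S' = S" by blast
  \<comment> \<open>The gap between the form and the maximal operator, with explicit coefficients so
    that it is literally a linear combination of local forms.\<close>
  define E where "E u \<phi> = 1 * D u \<phi> + (- 1) * blinfun_apply \<phi> (blinfun_apply S u)" for u \<phi>
  have E: "local_form E"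
    unfolding E_def[abs_def]
    by (intro local_form_linear_combination D local_form_central[OF central[OF S]])
  have Enn: "0 \<le> E u \<phi>" if "0 \<le> u" "positive_functional \<phi>" for u \<phi>
    using S that by (simp add: \<S>_def E_def)
  have "\<bar>E u \<phi>\<bar> \<le> K * blinfun_apply \<phi> u" if "0 \<le> u" "positive_functional \<phi>" for u \<phi>
    using Enn[OF that] dom[OF that] positive_functionalD[OF that(2) central_nonneg[OF central[OF S] that(1)]]
    by (simp add: E_def)
  then have Edom: "dominated_form K E" by (simp add: dominated_form_def)
  have E0: "E u \<phi> = 0" if u: "0 \<le> u" and \<phi>: "positive_functional \<phi>" for u \<phi>
  proof (rule ccontr)
    assume "E u \<phi> \<noteq> 0"
    then have gap: "0 < E u \<phi>" using Enn[OF u \<phi>] by simp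
    define t where "t = E u \<phi> / (blinfun_apply \<phi> u + 1)"
    have \<gamma>: "0 \<le> blinfun_apply \<phi> u" by (rule positive_functionalD[OF \<phi> u])
    have t: "0 < t" using gap \<gamma> by (simp add: t_def)
    have lt: "t * blinfun_apply \<phi> u < E u \<phi>" using gap \<gamma> by (simp add: t_def field_simps)
    obtain w where w: "0 \<le> w" "w \<noteq> 0"
      and low: "\<And>v \<phi>. 0 \<le> v \<Longrightarrow> v \<le> w \<Longrightarrow> positive_functional \<phi> \<Longrightarrow> t * blinfun_apply \<phi> v \<le> E v \<phi>"
      using local_form_uniform_lower_bound[OF E Edom D(3) \<phi> u lt] by blast
    define P where "P = principal_projection w"
    have P: "band_projection P" "blinfun_apply P w = w"
      unfolding P_def by (rule band_projection_principal[OF w(1)] principal_projection_self[OF w(1)])+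
    note Ppos = functional_nonneg_on_principal[OF w(1), folded P_def]
    \<comment> \<open>On the band, \<open>t * \<psi> (P v) \<le> E (P v) \<psi>\<close>, and
      positivity of \<open>E\<close> at \<open>v - P v\<close> bounds this by
      \<open>E v \<psi>\<close>. So the enlarged operator is still below \<open>D\<close>, against
      maximality.\<close>
    have "S + t *\<^sub>R P \<in> \<S>"
      unfolding \<S>_def
    proof (intro CollectI allI impI conjI)
      fix v :: 'a assume v: "0 \<le> v"
      have Pv: "0 \<le> blinfun_apply P v" by (rule band_projection_nonneg[OF P(1) v])
      show "0 \<le> blinfun_apply (S + t *\<^sub>R P) v"
        using t Pv central_nonneg[OF central[OF S] v]
        by (simp add: blinfun.add_left blinfun.scaleR_left scaleR_nonneg_nonneg)
      fix \<psi> :: "'a \<Rightarrow>\<^sub>L real" assume \<psi>: "positive_functional \<psi>"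
      have bl: "bounded_linear (\<lambda>v. E v \<psi> - t * blinfun_apply \<psi> v)"
        by (intro bounded_linear_sub bounded_linear_const_mult blinfun.bounded_linear_right local_formD(1) E)
      have "0 \<le> E (blinfun_apply P v) \<psi> - t * blinfun_apply \<psi> (blinfun_apply P v)"
        by (rule Ppos[OF bl _ v]) (use low \<psi> in simp)
      moreover have "0 \<le> E (v - blinfun_apply P v) \<psi>"
        using band_projection_le[OF P(1) v] by (intro Enn \<psi>) simp
      then have "E (blinfun_apply P v) \<psi> \<le> E v \<psi>"
        using linear_diff[OF bounded_linear.linear[OF local_formD(1)[OF E]]] by simp
      ultimately show "blinfun_apply \<psi> (blinfun_apply (S + t *\<^sub>R P) v) \<le> D v \<psi>"
        by (simp add: E_def blinfun.add_left blinfun.scaleR_left blinfun.add_right blinfun.scaleR_right)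
    qed
    moreover have "L S (S + t *\<^sub>R P)"
      using t band_projection_nonneg[OF P(1)]
      by (simp add: L_def blinfun.add_left blinfun.scaleR_left scaleR_nonneg_nonneg)
    ultimately have "S + t *\<^sub>R P = S" by (rule max)
    then have "t *\<^sub>R blinfun_apply P w = 0" by (metis add_cancel_left_right blinfun.scaleR_left blinfun.zero_left)
    then show False using t P(2) w(2) by simp
  qed
  show ?thesis
  proof (intro exI[of _ S] conjI allI impI central[OF S])
    fix u and \<phi> :: "'a \<Rightarrow>\<^sub>L real" assume \<phi>: "positive_functional \<phi>"
    have "E u \<phi> = 0"
    proof (rule eq_on_cone[of "\<lambda>u. E u \<phi>" "\<lambda>u. 0"])
      show "linear (\<lambda>u. E u \<phi>)" by (rule bounded_linear.linear[OF local_formD(1)[OF E]])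
      show "linear (\<lambda>u::'a. 0::real)" by (rule linearI) auto
    qed (rule E0[OF _ \<phi>])
    then show "blinfun_apply \<phi> (blinfun_apply S u) = D u \<phi>" by (simp add: E_def)
  qed
qed

subsection \<open>Sign operators\<close>

lemma band_projection_norm_le:
  assumes "band_projection P"
  shows "norm (blinfun_apply P u) \<le> norm u"
  using central_norm_le[of 1 P u] assms by (simp add: band_projection_def)

lemma band_projection_abs_le:
  assumes "band_projection P"
  shows "\<bar>blinfun_apply P u\<bar> \<le> blinfun_apply P \<bar>u\<bar>"
  using central_abs_le[of 1 P u] assms by (simp add: band_projection_def)

lemma band_projection_complement:
  assumes P: "band_projection P"
  shows "band_projection (id_blinfun - P)"
  unfolding band_projection_def central_def
proof (intro conjI allI impI)
  show "(id_blinfun - P) o\<^sub>L (id_blinfun - P) = id_blinfun - P"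
    by (rule blinfun_eqI) (simp add: blinfun.diff_left blinfun.diff_right band_projection_idem[OF P])
qed (use band_projection_nonneg[OF P] band_projection_le[OF P] in \<open>simp_all add: blinfun.diff_left\<close>)

text \<open>The infimum \<open>z\<close> is below \<open>P \<bar>a\<bar>\<close>, hence fixed by
  \<open>P\<close>, and below \<open>\<bar>b\<bar> - P \<bar>b\<bar>\<close>, hence annihilated by
  \<open>P\<close>.\<close>

lemma band_projection_disjoint:
  assumes P: "band_projection P"
  shows "lattice_disjoint (blinfun_apply P a) (b - blinfun_apply P b)"
proof -
  have Q: "band_projection (id_blinfun - P)" by (rule band_projection_complement[OF P])
  define z where "z = inf \<bar>blinfun_apply P a\<bar> \<bar>b - blinfun_apply P b\<bar>"
  have z0: "0 \<le> z" by (simp add: z_def)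
  have "z \<le> blinfun_apply P \<bar>a\<bar>"
    unfolding z_def by (rule le_infI1[OF band_projection_abs_le[OF P]])
  then have Pz: "blinfun_apply P z = z"
    by (rule band_projection_fixes[OF P band_projection_idem[OF P] z0])
  have "\<bar>b - blinfun_apply P b\<bar> \<le> \<bar>b\<bar> - blinfun_apply P \<bar>b\<bar>"
    using band_projection_abs_le[OF Q, of b] by (simp add: blinfun.diff_left)
  then have "z \<le> \<bar>b\<bar> - blinfun_apply P \<bar>b\<bar>" unfolding z_def by (rule le_infI2)
  then have "blinfun_apply P z \<le> blinfun_apply P (\<bar>b\<bar> - blinfun_apply P \<bar>b\<bar>)"
    by (rule band_projection_mono[OF P])
  then have "z \<le> 0" by (simp add: Pz blinfun.diff_right band_projection_idem[OF P])
  with z0 have "z = 0" by simp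
  then show ?thesis by (simp add: lattice_disjoint_def z_def)
qed

lemma lattice_disjoint_commute: "lattice_disjoint x y \<longleftrightarrow> lattice_disjoint y x"
  by (simp add: lattice_disjoint_def inf_commute)

text \<open>\<open>\<bar>v\<bar>\<close> is admissible in the supremum and equals its infimum with
  \<open>\<bar>T x\<bar>\<close>. In this form the hypothesis on \<open>T\<close> applies to
  components of \<open>T x\<close>.\<close>

lemma eps_band_preserving_disjoint_part:
  assumes T: "eps_band_preserving \<epsilon> T" and v: "\<bar>v\<bar> \<le> \<bar>T x\<bar>" "lattice_disjoint v x"
  shows "norm v \<le> \<epsilon> * norm x"
proof -
  define Y where "Y = {y. 0 \<le> y \<and> lattice_disjoint y x}"
  have "\<bar>v\<bar> \<in> Y" using v by (simp add: Y_def lattice_disjoint_def)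
  have "norm v = norm (inf \<bar>T x\<bar> \<bar>v\<bar>)" using v(1) by (simp add: inf_absorb2)
  also have "\<dots> \<le> (SUP y\<in>Y. norm (inf \<bar>T x\<bar> y))"
  proof (rule cSUP_upper[OF \<open>\<bar>v\<bar> \<in> Y\<close>])
    show "bdd_above ((\<lambda>y. norm (inf \<bar>T x\<bar> y)) ` Y)"
      by (rule bdd_aboveI2[of _ _ "norm \<bar>T x\<bar>"]) (rule norm_mono_nonneg, auto simp: Y_def)
  qed
  also have "\<dots> \<le> \<epsilon> * norm x" using T by (simp add: eps_band_preserving_def Y_def)
  finally show ?thesis .
qed

text \<open>The reflection with sign 1 on the band and sign -1 on its complement.\<close>

definition sign_operator :: "('a::banach_lattice \<Rightarrow>\<^sub>L 'a) \<Rightarrow> ('a \<Rightarrow>\<^sub>L 'a)"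
  where "sign_operator P = 2 *\<^sub>R P - id_blinfun"

lemma sign_operator_apply: "blinfun_apply (sign_operator P) u = 2 *\<^sub>R blinfun_apply P u - u"
  by (simp add: sign_operator_def blinfun.diff_left blinfun.scaleR_left)

lemma sign_operator_norm_le:
  assumes P: "band_projection P"
  shows "norm (blinfun_apply (sign_operator P) u) \<le> norm u"
proof -
  have Q: "band_projection (id_blinfun - P)" by (rule band_projection_complement[OF P])
  have "\<bar>blinfun_apply (sign_operator P) u\<bar> = \<bar>blinfun_apply P u - (u - blinfun_apply P u)\<bar>"
    by (simp add: sign_operator_apply scaleR_2 algebra_simps)
  also have "\<dots> \<le> \<bar>blinfun_apply P u\<bar> + \<bar>u - blinfun_apply P u\<bar>" by (rule abs_triangle_ineq4)
  also have "\<dots> \<le> blinfun_apply P \<bar>u\<bar> + (\<bar>u\<bar> - blinfun_apply P \<bar>u\<bar>)"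
    using band_projection_abs_le[OF P, of u] band_projection_abs_le[OF Q, of u]
    by (intro add_mono) (simp_all add: blinfun.diff_left)
  finally have "\<bar>blinfun_apply (sign_operator P) u\<bar> \<le> \<bar>u\<bar>" by simp
  then show ?thesis by (rule norm_mono_abs)
qed

lemma sign_operator_conj_norm_le:
  assumes P: "band_projection P"
  shows "norm (sign_operator P o\<^sub>L S o\<^sub>L sign_operator P) \<le> norm S"
proof (rule norm_blinfun_bound)
  fix x
  have "norm (blinfun_apply (sign_operator P o\<^sub>L S o\<^sub>L sign_operator P) x)
      \<le> norm (blinfun_apply S (blinfun_apply (sign_operator P) x))"
    by (simp add: sign_operator_norm_le[OF P])
  also have "\<dots> \<le> norm S * norm (blinfun_apply (sign_operator P) x)" by (rule norm_blinfun)
  also have "\<dots> \<le> norm S * norm x" by (intro mult_left_mono sign_operator_norm_le[OF P]) simp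
  finally show "norm (blinfun_apply (sign_operator P o\<^sub>L S o\<^sub>L sign_operator P) x) \<le> norm S * norm x" .
qed simp

text \<open>Signs multiply: the product has sign 1 where both signs agree, so \<open>E\<close> is
  \<open>P Q + (1 - P) (1 - Q)\<close>.\<close>

lemma sign_operator_compose:
  assumes P: "band_projection P" and Q: "band_projection Q"
  obtains E where "band_projection E" "sign_operator P o\<^sub>L sign_operator Q = sign_operator E"
    "sign_operator Q o\<^sub>L sign_operator P = sign_operator E"
proof -
  define E where "E = id_blinfun - P - Q + 2 *\<^sub>R (P o\<^sub>L Q)"
  note com = band_projections_commute[OF Q P]
  note simps = blinfun.diff_left blinfun.add_left blinfun.scaleR_left blinfun.diff_right
    blinfun.add_right blinfun.scaleR_right com band_projection_idem[OF P] band_projection_idem[OF Q]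
  have E: "blinfun_apply E u = u - blinfun_apply P u - blinfun_apply Q u + 2 *\<^sub>R blinfun_apply P (blinfun_apply Q u)" for u
    by (simp add: E_def simps)
  have Q': "0 \<le> u - blinfun_apply Q u" and P': "0 \<le> u - blinfun_apply P u" if "0 \<le> u" for u
    using band_projection_le[OF Q that] band_projection_le[OF P that] by auto
  have "band_projection E"
    unfolding band_projection_def central_def
  proof (intro conjI allI impI)
    fix u :: 'a assume u: "0 \<le> u"
    have "0 \<le> blinfun_apply P (blinfun_apply Q u)"
      by (intro band_projection_nonneg[OF P] band_projection_nonneg[OF Q] u)
    moreover have "0 \<le> (u - blinfun_apply Q u) - blinfun_apply P (u - blinfun_apply Q u)"
      by (intro P' Q' u)
    ultimately have "0 \<le> blinfun_apply P (blinfun_apply Q u) +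
        ((u - blinfun_apply Q u) - blinfun_apply P (u - blinfun_apply Q u))"
      by (rule add_nonneg_nonneg)
    then show "0 \<le> blinfun_apply E u" by (simp add: E simps scaleR_2 algebra_simps)
    have "0 \<le> blinfun_apply P (u - blinfun_apply Q u)" "0 \<le> blinfun_apply Q (u - blinfun_apply P u)"
      by (intro band_projection_nonneg[OF P] band_projection_nonneg[OF Q] P' Q' u)+
    then have "0 \<le> blinfun_apply P (u - blinfun_apply Q u) + blinfun_apply Q (u - blinfun_apply P u)"
      by (rule add_nonneg_nonneg)
    also have "\<dots> = u - blinfun_apply E u" by (simp add: E simps scaleR_2 algebra_simps)
    finally show "blinfun_apply E u \<le> 1 *\<^sub>R u" by simp
  next
    show "E o\<^sub>L E = E"
      by (rule blinfun_eqI) (simp add: E simps scaleR_2 algebra_simps)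
  qed
  moreover have "sign_operator P o\<^sub>L sign_operator Q = sign_operator E"
    "sign_operator Q o\<^sub>L sign_operator P = sign_operator E"
    by (rule blinfun_eqI, simp add: sign_operator_apply E simps scaleR_2 algebra_simps)+
  ultimately show ?thesis by (rule that)
qed

text \<open>The vectors \<open>a\<close> and \<open>b\<close> are the off-diagonal contributions.
  Each is disjoint from the vector to which \<open>T\<close> was applied, so each has norm at most
  \<open>\<epsilon> * norm x\<close>, and the difference is twice their sum.\<close>

lemma eps_band_preserving_sign_conj:
  fixes T :: "'a::banach_lattice \<Rightarrow>\<^sub>L 'a"
  assumes \<epsilon>: "0 \<le> \<epsilon>" and T: "eps_band_preserving \<epsilon> (blinfun_apply T)" and P: "band_projection P"
  shows "norm (T - (sign_operator P o\<^sub>L T o\<^sub>L sign_operator P)) \<le> 4 * \<epsilon>"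
proof (rule norm_blinfun_bound)
  fix x
  have Q: "band_projection (id_blinfun - P)" by (rule band_projection_complement[OF P])
  define Px where "Px = blinfun_apply P x"
  define Qx where "Qx = x - blinfun_apply P x"
  define a where "a = blinfun_apply P (blinfun_apply T Qx)"
  define b where "b = blinfun_apply T Px - blinfun_apply P (blinfun_apply T Px)"
  have "\<bar>a\<bar> \<le> \<bar>blinfun_apply T Qx\<bar>"
    unfolding a_def by (rule order.trans[OF band_projection_abs_le[OF P] band_projection_le[OF P abs_ge_zero]])
  moreover have "lattice_disjoint a Qx"
    unfolding a_def Qx_def by (rule band_projection_disjoint[OF P])
  ultimately have "norm a \<le> \<epsilon> * norm Qx" by (rule eps_band_preserving_disjoint_part[OF T])
  also have "\<dots> \<le> \<epsilon> * norm x"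
    using band_projection_norm_le[OF Q, of x] \<epsilon> by (intro mult_left_mono) (simp_all add: Qx_def blinfun.diff_left)
  finally have a: "norm a \<le> \<epsilon> * norm x" .
  have "\<bar>b\<bar> \<le> \<bar>blinfun_apply T Px\<bar>"
    using order.trans[OF band_projection_abs_le[OF Q] band_projection_le[OF Q abs_ge_zero], of "blinfun_apply T Px"]
    by (simp add: b_def blinfun.diff_left)
  moreover have "lattice_disjoint b Px"
    unfolding b_def Px_def by (subst lattice_disjoint_commute) (rule band_projection_disjoint[OF P])
  ultimately have "norm b \<le> \<epsilon> * norm Px" by (rule eps_band_preserving_disjoint_part[OF T])
  also have "\<dots> \<le> \<epsilon> * norm x"
    using band_projection_norm_le[OF P, of x] \<epsilon> by (intro mult_left_mono) (simp_all add: Px_def)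
  finally have b: "norm b \<le> \<epsilon> * norm x" .
  have "blinfun_apply (T - (sign_operator P o\<^sub>L T o\<^sub>L sign_operator P)) x = 2 *\<^sub>R (a + b)"
    by (simp add: a_def b_def Px_def Qx_def sign_operator_apply blinfun.diff_left blinfun.diff_right
        blinfun.scaleR_right scaleR_2 blinfun.add_right algebra_simps)
  then have "norm (blinfun_apply (T - (sign_operator P o\<^sub>L T o\<^sub>L sign_operator P)) x) = 2 * norm (a + b)"
    by simp
  also have "\<dots> \<le> 2 * (norm a + norm b)" by (intro mult_left_mono norm_triangle_ineq) simp
  also have "\<dots> \<le> 4 * \<epsilon> * norm x" using a b by simp
  finally show "norm (blinfun_apply (T - (sign_operator P o\<^sub>L T o\<^sub>L sign_operator P)) x) \<le> 4 * \<epsilon> * norm x" .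
qed (use \<epsilon> in simp)

lemma band_projection_id: "band_projection id_blinfun"
  by (simp add: band_projection_def central_id_blinfun blinfun_eqI)

section \<open>Averages over sign operators and their limits\<close>

text \<open>Projections are added one at a time: averaging \<open>S\<close> with its conjugate by
  the sign operator of \<open>P\<close> removes the parts of \<open>S\<close> that mix the band with
  its complement.\<close>

lemma approximant_commuting_with_finite_set:
  fixes T :: "'a::banach_lattice \<Rightarrow>\<^sub>L 'a"
  assumes \<epsilon>: "0 \<le> \<epsilon>" and T: "eps_band_preserving \<epsilon> (blinfun_apply T)"
    and "finite F" "\<And>P. P \<in> F \<Longrightarrow> band_projection P"
  shows "\<exists>S. norm S \<le> norm T \<and> norm (T - S) \<le> 4 * \<epsilon> \<and>
    (\<forall>P\<in>F. \<forall>x. blinfun_apply S (blinfun_apply P x) = blinfun_apply P (blinfun_apply S x))"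
proof -
  \<comment> \<open>The induction carries the estimate for all conjugates of \<open>S\<close>,
    because a conjugate of the average is an average of two conjugates of \<open>S\<close>. The
    identity as \<open>V\<close> recovers the claim.\<close>
  have "\<exists>S. norm S \<le> norm T \<and>
      (\<forall>V. band_projection V \<longrightarrow> norm (T - (sign_operator V o\<^sub>L S o\<^sub>L sign_operator V)) \<le> 4 * \<epsilon>) \<and>
      (\<forall>P\<in>F. \<forall>x. blinfun_apply S (blinfun_apply P x) = blinfun_apply P (blinfun_apply S x))"
    using assms(3,4)
  proof (induction F)
    case empty
    then show ?case using eps_band_preserving_sign_conj[OF \<epsilon> T] by auto
  next
    case (insert P F)
    then obtain S where S: "norm S \<le> norm T"
      "\<And>V. band_projection V \<Longrightarrow> norm (T - (sign_operator V o\<^sub>L S o\<^sub>L sign_operator V)) \<le> 4 * \<epsilon>"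
      "\<And>Q x. Q \<in> F \<Longrightarrow> blinfun_apply S (blinfun_apply Q x) = blinfun_apply Q (blinfun_apply S x)"
      by auto
    have P: "band_projection P" using insert.prems by simp
    define U where "U = sign_operator P"
    define S' where "S' = (1/2) *\<^sub>R (S + (U o\<^sub>L S o\<^sub>L U))"
    have S'_apply: "blinfun_apply S' x = (1/2) *\<^sub>R (blinfun_apply S x + blinfun_apply U (blinfun_apply S (blinfun_apply U x)))" for x
      by (simp add: S'_def blinfun.scaleR_left blinfun.add_left)
    have "norm (S + (U o\<^sub>L S o\<^sub>L U)) \<le> 2 * norm T"
      using norm_triangle_ineq[of S "U o\<^sub>L S o\<^sub>L U"] sign_operator_conj_norm_le[OF P, of S] S(1)
      by (simp add: U_def)
    then have "norm S' \<le> norm T" by (simp add: S'_def)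
    moreover have "norm (T - (sign_operator V o\<^sub>L S' o\<^sub>L sign_operator V)) \<le> 4 * \<epsilon>"
      if V: "band_projection V" for V
    proof -
      define W where "W = sign_operator V"
      obtain E where E: "band_projection E" "W o\<^sub>L U = sign_operator E" "U o\<^sub>L W = sign_operator E"
        unfolding W_def U_def by (rule sign_operator_compose[OF V P])
      have "T - (W o\<^sub>L S' o\<^sub>L W) = (1/2) *\<^sub>R ((T - (W o\<^sub>L S o\<^sub>L W)) + (T - ((W o\<^sub>L U) o\<^sub>L S o\<^sub>L (U o\<^sub>L W))))"
      proof (rule blinfun_eqI)
        fix x
        have "blinfun_apply T x = (1/2) *\<^sub>R (blinfun_apply T x + blinfun_apply T x)"
          by (simp flip: scaleR_2)
        then show "blinfun_apply (T - (W o\<^sub>L S' o\<^sub>L W)) x = blinfun_apply ((1/2) *\<^sub>R ((T - (W o\<^sub>L S o\<^sub>L W)) + (T - ((W o\<^sub>L U) o\<^sub>L S o\<^sub>L (U o\<^sub>L W))))) x"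
          by (simp add: S'_apply blinfun.diff_left blinfun.scaleR_left blinfun.add_left
              blinfun.scaleR_right blinfun.add_right algebra_simps)
      qed
      then have "norm (T - (W o\<^sub>L S' o\<^sub>L W)) =
          (1/2) * norm ((T - (W o\<^sub>L S o\<^sub>L W)) + (T - (sign_operator E o\<^sub>L S o\<^sub>L sign_operator E)))"
        by (simp add: E)
      also have "\<dots> \<le> (1/2) * (4 * \<epsilon> + 4 * \<epsilon>)"
        using S(2)[OF V] S(2)[OF E(1)] by (intro mult_left_mono norm_triangle_le) (simp_all add: W_def)
      finally show ?thesis by (simp add: W_def)
    qed
    moreover have "blinfun_apply S' (blinfun_apply Q x) = blinfun_apply Q (blinfun_apply S' x)"
      if Q: "Q \<in> insert P F" for Q x
    proof (cases "Q = P")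
      case True
      \<comment> \<open>\<open>P\<close> absorbs its sign operator and
        \<open>y + U y = 2 P y\<close>, so both \<open>S' P\<close> and \<open>P S'\<close> reduce
        to \<open>P S P\<close>.\<close>
      have PU: "blinfun_apply P (blinfun_apply U y) = blinfun_apply P y" "blinfun_apply U (blinfun_apply P y) = blinfun_apply P y" for y
        by (simp_all add: U_def sign_operator_apply blinfun.diff_right blinfun.scaleR_right
            blinfun.add_right band_projection_idem[OF P] scaleR_2)
      have *: "y + blinfun_apply U y = 2 *\<^sub>R blinfun_apply P y" for y
        by (simp add: U_def sign_operator_apply)
      have "blinfun_apply S' (blinfun_apply P x) = blinfun_apply P (blinfun_apply S (blinfun_apply P x))"
        by (simp add: S'_apply PU *)
      moreover have "blinfun_apply P (blinfun_apply S' x) = (1/2) *\<^sub>R blinfun_apply P (blinfun_apply S (x + blinfun_apply U x))"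
        by (simp add: S'_apply PU blinfun.scaleR_right blinfun.add_right)
      then have "blinfun_apply P (blinfun_apply S' x) = blinfun_apply P (blinfun_apply S (blinfun_apply P x))"
        by (simp add: * blinfun.scaleR_right)
      ultimately show ?thesis using True by simp
    next
      case False
      with Q have QF: "Q \<in> F" "band_projection Q" using insert.prems by auto
      \<comment> \<open>Since \<open>U\<close> commutes with \<open>Q\<close>, the commutation
        achieved earlier survives the averaging.\<close>
      have "blinfun_apply U (blinfun_apply Q y) = blinfun_apply Q (blinfun_apply U y)" for y
        by (simp add: U_def sign_operator_apply blinfun.diff_right blinfun.scaleR_right
            band_projections_commute[OF P QF(2)])
      then show ?thesis
        by (simp add: S'_apply S(3)[OF QF(1)] blinfun.scaleR_right blinfun.add_right)
    qed
    ultimately show ?case by blast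
  qed
  moreover have "sign_operator id_blinfun = (id_blinfun :: 'a \<Rightarrow>\<^sub>L 'a)"
    by (rule blinfun_eqI) (simp add: sign_operator_apply scaleR_2)
  then have "sign_operator id_blinfun o\<^sub>L S o\<^sub>L sign_operator id_blinfun = S" for S :: "'a \<Rightarrow>\<^sub>L 'a"
    by (intro blinfun_eqI) simp
  ultimately show ?thesis using band_projection_id by metis
qed

text \<open>Tychonoff's theorem: all \<open>g i\<close> lie in a compact product of intervals, so
  the image filter has a cluster point \<open>l\<close>.\<close>

lemma pointwise_bounded_convergent_subfilter:
  fixes g :: "'i \<Rightarrow> 'b \<Rightarrow> real"
  assumes F: "F \<noteq> bot" and bd: "\<And>i b. \<bar>g i b\<bar> \<le> c b"
  shows "\<exists>H l. H \<le> F \<and> H \<noteq> bot \<and> (\<forall>b. ((\<lambda>i. g i b) \<longlongrightarrow> l b) H)"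
proof -
  define K where "K = (\<Pi>\<^sub>E b\<in>UNIV. {- c b..c b})"
  have "compactin (product_topology (\<lambda>b::'b. euclidean) UNIV) K"
    unfolding K_def compactin_PiE by (simp add: compactin_euclidean_iff)
  then have "compact K" by (simp add: euclidean_product_topology compactin_euclidean_iff)
  moreover have "filtermap g F \<noteq> bot" using F by (simp add: filtermap_bot_iff)
  moreover have "g i \<in> K" for i using bd by (auto simp: K_def PiE_def abs_le_iff minus_le_iff)
  then have "eventually (\<lambda>x. x \<in> K) (filtermap g F)" by (simp add: eventually_filtermap)
  ultimately obtain l where l: "inf (nhds l) (filtermap g F) \<noteq> bot"
    unfolding compact_filter by blast
  \<comment> \<open>\<open>F\<close> refined by the preimages of neighbourhoods of \<open>l\<close>;
    clustering at \<open>l\<close> is what makes it proper.\<close>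
  define H where "H = inf F (filtercomap g (nhds l))"
  have "H \<noteq> bot"
  proof
    assume "H = bot"
    then have "eventually (\<lambda>_. False) (inf F (filtercomap g (nhds l)))" by (simp add: H_def)
    then obtain Q R where QR: "eventually Q F" "eventually R (nhds l)" "\<And>i. Q i \<Longrightarrow> R (g i) \<Longrightarrow> False"
      unfolding eventually_inf eventually_filtercomap by blast
    have "eventually (\<lambda>x. \<not> R x) (filtermap g F)"
      unfolding eventually_filtermap using QR(1) by eventually_elim (use QR(3) in blast)
    with QR(2) have "eventually (\<lambda>_. False) (inf (nhds l) (filtermap g F))"
      unfolding eventually_inf by blast
    then show False using l by (simp add: trivial_limit_def)
  qed
  moreover have "H \<le> F" by (simp add: H_def)
  moreover have "filterlim g (nhds l) H"
    unfolding H_def by (rule filterlim_mono[OF filterlim_filtercomap order.refl]) simp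
  then have "((\<lambda>i. g i b) \<longlongrightarrow> l b) H" for b
    using continuous_on_tendsto_compose[OF continuous_on_product_coordinates, of g l H b] by simp
  ultimately show ?thesis by blast
qed

text \<open>The limit runs along finite sets of band projections ordered by inclusion, so
  commutation with each fixed projection eventually holds.\<close>

lemma eps_band_preserving_local_form:
  fixes T :: "'a::order_continuous_banach_lattice \<Rightarrow>\<^sub>L 'a"
  assumes \<epsilon>: "0 \<le> \<epsilon>" and T: "eps_band_preserving \<epsilon> (blinfun_apply T)"
  shows "\<exists>B. local_form B \<and> (\<forall>u \<phi>. \<bar>B u \<phi>\<bar> \<le> norm T * norm u * norm \<phi>) \<and>
    (\<forall>u \<phi>. \<bar>blinfun_apply \<phi> (blinfun_apply T u) - B u \<phi>\<bar> \<le> 4 * \<epsilon> * norm u * norm \<phi>)"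
proof -
  define F where "F = finite_subsets_at_top {P :: 'a \<Rightarrow>\<^sub>L 'a. band_projection P}"
  \<comment> \<open>Finiteness of \<open>X\<close> sits inside the commutation condition, so that an
    approximant exists for every \<open>X\<close>; for infinite \<open>X\<close> this condition is
    empty.\<close>
  define good where "good X S \<longleftrightarrow> norm S \<le> norm T \<and> norm (T - S) \<le> 4 * \<epsilon> \<and>
    (\<forall>P\<in>{P. finite X \<and> P \<in> X \<and> band_projection P}. \<forall>x. blinfun_apply S (blinfun_apply P x) = blinfun_apply P (blinfun_apply S x))"
    for X and S :: "'a \<Rightarrow>\<^sub>L 'a"
  have "\<exists>S. good X S" for X
    unfolding good_def
    by (rule approximant_commuting_with_finite_set[OF \<epsilon> T]) (cases "finite X"; simp)+
  then obtain S where S: "\<And>X. good X (S X)" by metis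
  have nS: "norm (S X) \<le> norm T" "norm (T - S X) \<le> 4 * \<epsilon>" for X
    using S[of X] by (auto simp: good_def)
  have app: "\<bar>blinfun_apply \<phi> (blinfun_apply R u)\<bar> \<le> k * norm u * norm \<phi>"
    if "norm R \<le> k" for \<phi> :: "'a \<Rightarrow>\<^sub>L real" and R :: "'a \<Rightarrow>\<^sub>L 'a" and u k
  proof -
    have "\<bar>blinfun_apply \<phi> (blinfun_apply R u)\<bar> \<le> norm \<phi> * norm (blinfun_apply R u)"
      using norm_blinfun[of \<phi>] by (simp only: real_norm_def)
    also have "\<dots> \<le> norm \<phi> * (k * norm u)"
      using norm_blinfun[of R u] mult_right_mono[OF that norm_ge_zero[of u]]
      by (intro mult_left_mono order.trans[OF norm_blinfun]) auto
    finally show ?thesis by (simp add: mult_ac)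
  qed
  \<comment> \<open>Indexing by pairs lets a single subfilter serve all vectors and
    functionals.\<close>
  define g where "g X z = blinfun_apply (snd z) (blinfun_apply (S X) (fst z))"
    for X and z :: "'a \<times> ('a \<Rightarrow>\<^sub>L real)"
  have bd: "\<bar>g X z\<bar> \<le> norm T * norm (fst z) * norm (snd z)" for X z
    unfolding g_def by (rule app[OF nS(1)])
  have "F \<noteq> bot" by (simp add: F_def)
  from pointwise_bounded_convergent_subfilter[where g = g, OF this bd]
  obtain H l where H: "H \<le> F" "H \<noteq> bot" and l: "\<And>z. ((\<lambda>X. g X z) \<longlongrightarrow> l z) H"
    by blast
  define B where "B u \<phi> = l (u, \<phi>)" for u \<phi>
  have lim: "((\<lambda>X. blinfun_apply \<phi> (blinfun_apply (S X) u)) \<longlongrightarrow> B u \<phi>) H" for u \<phi>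
    using l[of "(u, \<phi>)"] by (simp add: B_def g_def)
  have B1: "\<bar>B u \<phi>\<bar> \<le> norm T * norm u * norm \<phi>" for u \<phi>
    by (rule tendsto_upperbound[OF tendsto_rabs[OF lim] _ H(2)]) (simp add: app[OF nS(1)])
  have B2: "\<bar>blinfun_apply \<phi> (blinfun_apply T u) - B u \<phi>\<bar> \<le> 4 * \<epsilon> * norm u * norm \<phi>" for u \<phi>
  proof (rule tendsto_upperbound[OF tendsto_rabs[OF tendsto_diff[OF tendsto_const lim]] _ H(2)])
    have "\<bar>blinfun_apply \<phi> (blinfun_apply T u) - blinfun_apply \<phi> (blinfun_apply (S X) u)\<bar> \<le> 4 * \<epsilon> * norm u * norm \<phi>" for X
      using app[OF nS(2), of \<phi> X u] by (simp add: blinfun.diff_left blinfun.diff_right)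
    then show "\<forall>\<^sub>F X in H. \<bar>blinfun_apply \<phi> (blinfun_apply T u) - blinfun_apply \<phi> (blinfun_apply (S X) u)\<bar> \<le> 4 * \<epsilon> * norm u * norm \<phi>"
      by simp
  qed
  have uniq: "x = y" if "(f \<longlongrightarrow> x) H" "(f \<longlongrightarrow> y) H" for f :: "('a \<Rightarrow>\<^sub>L 'a) set \<Rightarrow> real" and x y
    by (rule tendsto_unique[OF H(2) that])
  have "local_form B"
    unfolding local_form_def
  proof (intro conjI allI impI)
    fix \<phi>
    show "bounded_linear (\<lambda>u. B u \<phi>)"
    proof (rule bounded_linear_intro[where K = "norm T * norm \<phi>"])
      fix u v
      have "((\<lambda>X. blinfun_apply \<phi> (blinfun_apply (S X) (u + v))) \<longlongrightarrow> B u \<phi> + B v \<phi>) H"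
        unfolding blinfun.add_right by (intro tendsto_add lim)
      then show "B (u + v) \<phi> = B u \<phi> + B v \<phi>" by (rule uniq[OF lim])
    next
      fix r u
      have "((\<lambda>X. blinfun_apply \<phi> (blinfun_apply (S X) (r *\<^sub>R u))) \<longlongrightarrow> r *\<^sub>R B u \<phi>) H"
        unfolding blinfun.scaleR_right by (intro tendsto_scaleR tendsto_const lim)
      then show "B (r *\<^sub>R u) \<phi> = r *\<^sub>R B u \<phi>" by (rule uniq[OF lim])
    next
      fix u
      show "norm (B u \<phi>) \<le> norm u * (norm T * norm \<phi>)" using B1[of u \<phi>] by (simp add: mult_ac)
    qed
  next
    fix u
    show "linear (B u)"
    proof (rule linearI)
      fix \<phi> \<psi>
      have "((\<lambda>X. blinfun_apply (\<phi> + \<psi>) (blinfun_apply (S X) u)) \<longlongrightarrow> B u \<phi> + B u \<psi>) H"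
        unfolding blinfun.add_left by (intro tendsto_add lim)
      then show "B u (\<phi> + \<psi>) = B u \<phi> + B u \<psi>" by (rule uniq[OF lim])
    next
      fix r \<phi>
      have "((\<lambda>X. blinfun_apply (r *\<^sub>R \<phi>) (blinfun_apply (S X) u)) \<longlongrightarrow> r *\<^sub>R B u \<phi>) H"
        unfolding blinfun.scaleR_left by (intro tendsto_scaleR tendsto_const lim)
      then show "B u (r *\<^sub>R \<phi>) = r *\<^sub>R B u \<phi>" by (rule uniq[OF lim])
    qed
  next
    fix P :: "'a \<Rightarrow>\<^sub>L 'a" and u and \<phi> :: "'a \<Rightarrow>\<^sub>L real" assume P: "band_projection P"
    have "eventually (\<lambda>X. finite X \<and> P \<in> X) F"
      unfolding F_def eventually_finite_subsets_at_top using P by (intro exI[of _ "{P}"]) auto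
    then have "eventually (\<lambda>X. finite X \<and> P \<in> X) H" using H(1) by (rule filter_leD[rotated])
    then have "\<forall>\<^sub>F X in H. blinfun_apply \<phi> (blinfun_apply (S X) (blinfun_apply P u)) =
        blinfun_apply (\<phi> o\<^sub>L P) (blinfun_apply (S X) u)"
    proof eventually_elim
      case (elim X)
      then show ?case using S[of X] P by (simp add: good_def)
    qed
    from tendsto_cong[OF this] lim[of \<phi> "blinfun_apply P u"]
    have "((\<lambda>X. blinfun_apply (\<phi> o\<^sub>L P) (blinfun_apply (S X) u)) \<longlongrightarrow> B (blinfun_apply P u) \<phi>) H" by simp
    then show "B (blinfun_apply P u) \<phi> = B u (\<phi> o\<^sub>L P)" by (rule uniq[OF _ lim])
  qed
  then show ?thesis using B1 B2 by blast
qed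

section \<open>Norm estimates and the resulting operator\<close>

text \<open>The sign operator of the band of \<open>pprt y\<close> maps \<open>y\<close> to
  \<open>\<bar>y\<bar>\<close>, whose norm a positive functional attains. Norms can thus be tested
  with positive functionals, at which the operator representing a form is known.\<close>

lemma norm_eq_sign_functional:
  fixes y :: "'a::order_continuous_banach_lattice"
  obtains \<phi> :: "'a \<Rightarrow>\<^sub>L real" and P
  where "positive_functional \<phi>" "norm \<phi> \<le> 1" "band_projection P"
    "blinfun_apply \<phi> (blinfun_apply (sign_operator P) y) = norm y"
proof -
  obtain \<phi> :: "'a \<Rightarrow>\<^sub>L real" where \<phi>: "positive_functional \<phi>" "norm \<phi> \<le> 1"
    "blinfun_apply \<phi> \<bar>y\<bar> = norm (pprt \<bar>y\<bar>)"
    using positive_functional_supporting by blast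
  define P where "P = principal_projection (pprt y)"
  have Pp: "blinfun_apply P (pprt y) = pprt y"
    unfolding P_def by (rule principal_projection_self[OF zero_le_pprt])
  have "blinfun_apply P (- nprt y) = 0"
    unfolding P_def by (rule principal_projection_disjoint[OF zero_le_pprt _ inf_pprt_nprt]) simp
  then have "blinfun_apply P (pprt y - (- nprt y)) = pprt y" using Pp by (simp only: blinfun.diff_right) simp
  moreover have "pprt y - (- nprt y) = y" using prts[of y] by simp
  ultimately have "blinfun_apply (sign_operator P) y = pprt y + pprt y - y"
    by (simp add: sign_operator_apply scaleR_2)
  also have "\<dots> = pprt y + pprt y - (pprt y + nprt y)" by (subst (3) prts) simp
  also have "\<dots> = \<bar>y\<bar>" by (simp add: abs_prts)
  finally have "blinfun_apply (sign_operator P) y = \<bar>y\<bar>" .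
  then show ?thesis
    using \<phi> by (intro that[of \<phi> P]) (simp_all add: P_def band_projection_principal)
qed

text \<open>\<open>\<bar>S y\<bar> \<le> K *\<^sub>R \<bar>y\<bar>\<close> keeps \<open>S y\<close>
  in every ideal that contains \<open>y\<close>.\<close>

lemma band_preserving_central_shift:
  assumes S: "central K S"
  shows "band_preserving (blinfun_apply (S - c *\<^sub>R id_blinfun))"
  unfolding band_preserving_def
proof (intro conjI allI impI subsetI)
  show "linear (blinfun_apply (S - c *\<^sub>R id_blinfun))" by (rule linear_blinfun_apply)
  fix Y z assume Y: "band Y" and "z \<in> blinfun_apply (S - c *\<^sub>R id_blinfun) ` Y"
  then obtain y where y: "y \<in> Y" "z = blinfun_apply (S - c *\<^sub>R id_blinfun) y" by blast
  have sub: "subspace Y" and ideal: "\<And>x y. y \<in> Y \<Longrightarrow> \<bar>x\<bar> \<le> \<bar>y\<bar> \<Longrightarrow> x \<in> Y"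
    using Y by (auto simp: band_def order_ideal_def)
  have "\<bar>y\<bar> \<in> Y" by (rule ideal[OF y(1)]) simp
  then have "K *\<^sub>R \<bar>y\<bar> \<in> Y" by (rule subspace_scale[OF sub])
  moreover have "\<bar>blinfun_apply S y\<bar> \<le> \<bar>K *\<^sub>R \<bar>y\<bar>\<bar>"
    using central_abs_le[OF S, of y] central_le[OF S abs_ge_zero[of y]] abs_ge_self[of "K *\<^sub>R \<bar>y\<bar>"]
    by (meson order.trans)
  ultimately have "blinfun_apply S y \<in> Y" by (rule ideal)
  then have "blinfun_apply S y - c *\<^sub>R y \<in> Y"
    by (intro subspace_diff[OF sub] subspace_scale[OF sub] y)
  then show "z \<in> Y" by (simp add: y(2) blinfun.diff_left blinfun.scaleR_left)
qed

theorem theorem5p1: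
  fixes T :: "'a::order_continuous_banach_lattice \<Rightarrow>\<^sub>L 'a" and \<epsilon> :: real
  assumes "\<epsilon> \<ge> 0"
    and "eps_band_preserving \<epsilon> (blinfun_apply T)"
  shows "\<exists>R :: 'a \<Rightarrow>\<^sub>L 'a. band_preserving (blinfun_apply R) \<and> norm R \<le> norm T \<and> norm (T - R) \<le> 4 * \<epsilon>"
proof -
  define C where "C = norm T"
  have C: "0 \<le> C" by (simp add: C_def)
  obtain B where B: "local_form B" and B1: "\<And>u \<phi>. \<bar>B u \<phi>\<bar> \<le> C * norm u * norm \<phi>"
    and B2: "\<And>u \<phi>. \<bar>blinfun_apply \<phi> (blinfun_apply T u) - B u \<phi>\<bar> \<le> 4 * \<epsilon> * norm u * norm \<phi>"
    using eps_band_preserving_local_form[OF assms] unfolding C_def by blast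
  have Bdom: "B u \<phi> \<le> C * blinfun_apply \<phi> u" "- B u \<phi> \<le> C * blinfun_apply \<phi> u"
    if "0 \<le> u" "positive_functional \<phi>" for u \<phi>
    using local_form_le_norm_bound[OF B abs_le_D1[OF B1] C that]
      local_form_le_norm_bound[OF local_form_uminus[OF B] abs_le_D2[OF B1] C that]
    by auto
  \<comment> \<open>Adding \<open>C\<close> times the identity makes the form nonnegative, as its
    representation requires; the shift is taken off again in \<open>R\<close>.\<close>
  define D where "D u \<phi> = 1 * B u \<phi> + C * blinfun_apply \<phi> u" for u \<phi>
  have D: "local_form D"
    unfolding D_def[abs_def] by (intro local_form_linear_combination B local_form_apply)
  have D0: "0 \<le> D u \<phi>" if "0 \<le> u" "positive_functional \<phi>" for u \<phi>
    using Bdom[OF that] by (simp add: D_def)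
  have dom: "dominated_form (2 * C) D"
    unfolding dominated_form_def
  proof (intro allI impI)
    fix u :: 'a and \<phi> :: "'a \<Rightarrow>\<^sub>L real" assume *: "0 \<le> u" "positive_functional \<phi>"
    show "\<bar>D u \<phi>\<bar> \<le> 2 * C * blinfun_apply \<phi> u" using D0[OF *] Bdom[OF *] by (simp add: D_def)
  qed
  obtain S where S: "central (2 * C) S"
    and SD: "\<And>u \<phi>. positive_functional \<phi> \<Longrightarrow> blinfun_apply \<phi> (blinfun_apply S u) = D u \<phi>"
    using local_form_represented[OF D dom _ D0] C by auto
  define R where "R = S - C *\<^sub>R id_blinfun"
  have RB: "blinfun_apply \<phi> (blinfun_apply R u) = B u \<phi>" if "positive_functional \<phi>" for u \<phi>
    using SD[OF that, of u] by (simp add: R_def D_def blinfun.diff_left blinfun.diff_right blinfun.scaleR_left blinfun.scaleR_right)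
  have Rsign: "blinfun_apply (sign_operator P) (blinfun_apply R u) = blinfun_apply R (blinfun_apply (sign_operator P) u)"
    if "band_projection P" for P u
    using central_commutes_band_projection[OF S that, of u]
    by (simp add: R_def sign_operator_apply blinfun.diff_left blinfun.diff_right blinfun.scaleR_left
        blinfun.scaleR_right algebra_simps)
  \<comment> \<open>The functional on the right need not be positive, but the norm bounds
    \<open>B1\<close> and \<open>B2\<close> hold for all functionals.\<close>
  have Bsign: "B (blinfun_apply (sign_operator P) u) \<phi> = B u (\<phi> o\<^sub>L sign_operator P)"
    if P: "band_projection P" for P u \<phi>
  proof -
    interpret Bu: bounded_linear "\<lambda>u. B u \<phi>" by (rule local_formD(1)[OF B])
    have "\<phi> o\<^sub>L sign_operator P = 2 *\<^sub>R (\<phi> o\<^sub>L P) - \<phi>"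
      by (rule blinfun_eqI) (simp add: sign_operator_apply blinfun.diff_left blinfun.diff_right
          blinfun.scaleR_left blinfun.scaleR_right)
    then have "B u (\<phi> o\<^sub>L sign_operator P) = 2 * B u (\<phi> o\<^sub>L P) - B u \<phi>"
      using local_formD(2)[OF B, of u] by (simp add: linear_diff linear_scale)
    also have "\<dots> = 2 * B (blinfun_apply P u) \<phi> - B u \<phi>" by (simp add: local_formD(3)[OF B P])
    also have "\<dots> = B (blinfun_apply (sign_operator P) u) \<phi>"
      by (simp add: sign_operator_apply Bu.diff Bu.scaleR)
    finally show ?thesis ..
  qed
  have nsign: "norm (\<phi> o\<^sub>L sign_operator P) \<le> 1"
    if "band_projection P" "norm \<phi> \<le> 1" for P and \<phi> :: "'a \<Rightarrow>\<^sub>L real"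
  proof (rule norm_blinfun_bound)
    fix u
    have "norm (blinfun_apply (\<phi> o\<^sub>L sign_operator P) u) \<le> norm \<phi> * norm (blinfun_apply (sign_operator P) u)"
      by (simp only: blinfun_apply_blinfun_compose norm_blinfun)
    also have "\<dots> \<le> 1 * norm u" by (intro mult_mono that sign_operator_norm_le) auto
    finally show "norm (blinfun_apply (\<phi> o\<^sub>L sign_operator P) u) \<le> 1 * norm u" .
  qed simp
  have scale1: "a * norm u * norm \<phi> \<le> a * norm u" if "0 \<le> a" "norm \<phi> \<le> 1" for a and u :: 'a and \<phi> :: "'a \<Rightarrow>\<^sub>L real"
    using mult_left_mono[OF that(2), of "a * norm u"] that(1) by simp
  have "norm R \<le> norm T"
  proof (rule norm_blinfun_bound)
    fix u
    obtain \<phi> :: "'a \<Rightarrow>\<^sub>L real" and P where *: "positive_functional \<phi>" "norm \<phi> \<le> 1" "band_projection P"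
      "blinfun_apply \<phi> (blinfun_apply (sign_operator P) (blinfun_apply R u)) = norm (blinfun_apply R u)"
      by (rule norm_eq_sign_functional)
    \<comment> \<open>The sign operator moves through \<open>R\<close> to \<open>u\<close> and then,
      by locality, onto the functional; in between, \<open>R\<close> is replaced by \<open>B\<close>
      at the positive \<open>\<phi>\<close>.\<close>
    have "norm (blinfun_apply R u) = B u (\<phi> o\<^sub>L sign_operator P)"
      using *(4) by (simp only: Rsign[OF *(3)] RB[OF *(1)] Bsign[OF *(3)])
    also have "\<dots> \<le> C * norm u"
      using B1[of u "\<phi> o\<^sub>L sign_operator P"] scale1[OF C nsign[OF *(3,2)], of u] by simp
    finally show "norm (blinfun_apply R u) \<le> norm T * norm u" by (simp add: C_def)
  qed simp
  moreover have "norm (T - R) \<le> 4 * \<epsilon>"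
  proof (rule norm_blinfun_bound)
    fix u
    obtain \<phi> :: "'a \<Rightarrow>\<^sub>L real" and P where *: "positive_functional \<phi>" "norm \<phi> \<le> 1" "band_projection P"
      "blinfun_apply \<phi> (blinfun_apply (sign_operator P) (blinfun_apply (T - R) u)) = norm (blinfun_apply (T - R) u)"
      by (rule norm_eq_sign_functional)
    have "norm (blinfun_apply (T - R) u) = blinfun_apply (\<phi> o\<^sub>L sign_operator P) (blinfun_apply T u) - B u (\<phi> o\<^sub>L sign_operator P)"
      using *(4) by (simp only: blinfun.diff_left blinfun.diff_right Rsign[OF *(3)] RB[OF *(1)] Bsign[OF *(3)] blinfun_apply_blinfun_compose)
    also have "\<dots> \<le> 4 * \<epsilon> * norm u"
      using B2[of "\<phi> o\<^sub>L sign_operator P" u] scale1[OF _ nsign[OF *(3,2)], of "4 * \<epsilon>" u] assms(1) by simp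
    finally show "norm (blinfun_apply (T - R) u) \<le> 4 * \<epsilon> * norm u" .
  qed (use assms in simp)
  moreover have "band_preserving (blinfun_apply R)"
    unfolding R_def by (rule band_preserving_central_shift[OF S])
  ultimately show ?thesis by blast
qed

end
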